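(* Let $\Omega,\Lambda\subset\mathbb{R}^n$ be smooth, open, connected, bounded domains such that some hyperplane separates $\Omega$ and $\Lambda$, and such that there is $\delta>0$ with $|x-y|\ge\delta$ for all $(x,y)\in\Omega\times\Lambda$. Let $f,g\in L^1(\mathbb{R}^n)$ be nonnegative with $\int f=\int g=1$, $\operatorname{spt} f=\overline\Omega$, $\operatorname{spt} g=\overline\Lambda$, and $\beta_1\le f\le\beta_2$ on $\Omega$, $\beta_1\le g\le\beta_2$ on $\Lambda$ for some constants $\beta_1,\beta_2>0$. Let $c(x,y)=\tfrac12|x-y|^2$. Then the function $$\lambda\mapsto C_\lambda(f,g)=\inf_{\gamma\in\Gamma_{\le}(f,g)}\int_{\mathbb{R}^n\times\mathbb{R}^n}[c(x,y)-\lambda]\,d\gamma(x,y)$$ is a $C^{1,1}$ function of the parameter $\lambda\ge 0$.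
   Context: $\Gamma_{\le}(f,g)$ is the set of (nonnegative) Borel measures $\gamma$ on $\mathbb{R}^n\times\mathbb{R}^n$ with $\gamma(A\times\mathbb{R}^n)\le\int_A f\,dx$ and $\gamma(\mathbb{R}^n\times A)\le\int_A g\,dy$ for all Borel $A\subset\mathbb{R}^n$. A $C^{1,1}$ function is a differentiable function with Lipschitz derivative. *)

theory Defs
  imports "HOL-Analysis.Analysis"
begin

primrec C_k_on :: "nat \<Rightarrow> ('a::euclidean_space \<Rightarrow> real) \<Rightarrow> 'a set \<Rightarrow> bool" where
  "C_k_on 0 f U \<longleftrightarrow> continuous_on U f"
| "C_k_on (Suc k) f U \<longleftrightarrow>
     (\<forall>x\<in>U. f differentiable (at x)) \<and>
     (\<forall>b\<in>Basis. C_k_on k (\<lambda>x. frechet_derivative f (at x) b) U)"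

definition smooth_on :: "('a::euclidean_space \<Rightarrow> real) \<Rightarrow> 'a set \<Rightarrow> bool" where
  "smooth_on f U \<longleftrightarrow> (\<forall>k. C_k_on k f U)"

text \<open>A \<open>C\<^sup>\<infinity>\<close> boundary, described by local defining functions without critical points; the domain
  lies locally on one side of its boundary.\<close>

definition smooth_boundary :: "('a::euclidean_space) set \<Rightarrow> bool" where
  "smooth_boundary S \<longleftrightarrow>
     (\<forall>p\<in>frontier S. \<exists>U \<rho>. open U \<and> p \<in> U \<and> smooth_on \<rho> U \<and>
        (\<forall>x\<in>U. frechet_derivative \<rho> (at x) \<noteq> (\<lambda>v. 0)) \<and>
        S \<inter> U = {x\<in>U. \<rho> x < 0})"

definition smooth_bounded_domain :: "('a::euclidean_space) set \<Rightarrow> bool" where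
  "smooth_bounded_domain S \<longleftrightarrow> open S \<and> connected S \<and> bounded S \<and> smooth_boundary S"

definition hyperplane_separates :: "('a::euclidean_space) set \<Rightarrow> 'a set \<Rightarrow> bool" where
  "hyperplane_separates S T \<longleftrightarrow>
     (\<exists>a b. a \<noteq> 0 \<and> (\<forall>x\<in>S. a \<bullet> x \<le> b) \<and> (\<forall>y\<in>T. b \<le> a \<bullet> y))"

text \<open>The support of an \<open>L\<^sup>1\<close> function is that of its a.e. class: the smallest closed set outside
  which it vanishes almost everywhere.\<close>

definition spt :: "('a::euclidean_space \<Rightarrow> real) \<Rightarrow> 'a set" where
  "spt f = \<Inter>{K. closed K \<and> (AE x in lebesgue. x \<notin> K \<longrightarrow> f x = 0)}"

definition Gamma_le ::
  "('a::euclidean_space \<Rightarrow> real) \<Rightarrow> ('a \<Rightarrow> real) \<Rightarrow> ('a \<times> 'a) measure set" where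
  "Gamma_le f g =
     {\<gamma>. sets \<gamma> = sets borel \<and>
        (\<forall>A\<in>sets borel.
           emeasure \<gamma> (A \<times> UNIV) \<le> ennreal (LINT x:A|lebesgue. f x) \<and>
           emeasure \<gamma> (UNIV \<times> A) \<le> ennreal (LINT y:A|lebesgue. g y))}"

definition cost :: "'a::euclidean_space \<Rightarrow> 'a \<Rightarrow> real" where
  "cost x y = 1/2 * (norm (x - y))\<^sup>2"

text \<open>For nonnegative integrable \<open>f\<close> and \<open>g\<close> with bounded support, every \<open>\<gamma>\<close> in \<open>Gamma_le f g\<close> is
  finite and concentrated on a bounded set, so the integrand is integrable, and the infimum is over
  a nonempty set (the zero measure is admissible) that is bounded below.\<close>

definition C_cost ::
  "('a::euclidean_space \<Rightarrow> real) \<Rightarrow> ('a \<Rightarrow> real) \<Rightarrow> real \<Rightarrow> real" where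
  "C_cost f g l = (INF \<gamma>\<in>Gamma_le f g. LINT (x, y)|\<gamma>. cost x y - l)"

text \<open>At a boundary point of \<open>S\<close> the derivative is the one-sided one.\<close>

definition C11_on :: "real set \<Rightarrow> (real \<Rightarrow> real) \<Rightarrow> bool" where
  "C11_on S F \<longleftrightarrow>
     (\<exists>F'. (\<forall>x\<in>S. (F has_real_derivative F' x) (at x within S)) \<and>
           (\<exists>L. L-lipschitz_on S F'))"

end

theory Submission
  imports Defs
begin

text \<open>
  \<open>C_cost f g\<close> is an infimum of affine functions of \<open>\<lambda>\<close> with slopes minus the transported mass, hence
  concave; being \<open>C\<^sup>1\<^sup>,\<^sup>1\<close> then amounts to a bound \<open>C(\<lambda> + e) + C(\<lambda> - e) - 2 C(\<lambda>) \<ge> - K e\<^sup>2\<close>. By duality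
  this follows from strong convexity of the cost in the mass: for plans \<open>\<gamma>\<^sub>0\<close>, \<open>\<gamma>\<^sub>1\<close> there is a plan of the
  average mass which is cheaper than the average by \<open>k (m\<^sub>1 - m\<^sub>0)\<^sup>2\<close>.

  Where the first marginal of \<open>\<gamma>\<^sub>1\<close> exceeds that of \<open>\<gamma>\<^sub>0\<close>, the average plan uses \<open>f\<close> only partially, so
  mass \<open>m\<^sub>1 - m\<^sub>0\<close> of it may change its starting point within a region that has spare capacity. As
  \<open>|x - y| \<ge> \<delta>\<close>, a fixed fraction of this mass travels at least \<open>\<delta> / n\<close> along one signed coordinate
  direction. In each thin tube parallel to that direction, starting points are moved forward onto
  spare capacity. Since \<open>f \<le> \<beta>\<^sub>2\<close>, mass \<open>\<eta>\<close> in a tube of cross section \<open>a\<close> is spread over a length of order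
  \<open>\<eta> / (\<beta>\<^sub>2 a)\<close>, so the gain per tube is of order \<open>\<eta>\<^sup>2 / a\<close>, and Cauchy-Schwarz over the tubes gives the
  square of the total mass. The sideways displacement costs an amount that vanishes with the width of the tubes.
\<close>

section \<open>Concave functions with a second difference bound\<close>

text \<open>The second difference bound traps \<open>F\<close> between each supergradient line and
  that line minus a parabola, so supergradients are derivatives, and comparing the traps of two
  points bounds the change of slope. With both hypotheses on the whole line, one-sided derivatives
  on \<open>S\<close> are restrictions of two-sided ones.\<close>

lemma C11_on_of_concave_semiconvex:
  fixes F :: "real \<Rightarrow> real"
  assumes cv: "convex_on UNIV (\<lambda>x. - F x)"
    and semi: "\<And>x e. F (x + e) + F (x - e) \<ge> 2 * F x - K * e\<^sup>2"
  shows "C11_on S F"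
proof -
  \<comment> \<open>\<open>D x\<close> is the right derivative of \<open>F\<close>, the negative of
    that of the convex function \<open>- F\<close>; it is a supergradient at
    \<open>x\<close>.\<close>
  define D where "D x = - Inf ((\<lambda>t. ((- F x) - (- F t)) / (x - t)) ` ({x<..} \<inter> UNIV))" for x
  have up: "F y \<le> F x + D x * (y - x)" for x y
    using convex_le_Inf_differential[OF cv, of x y] unfolding D_def
    by (simp add: algebra_simps)
  \<comment> \<open>The supergradient line bounds \<open>F\<close> from above at the reflection of
    \<open>y\<close> in \<open>x\<close>, so the second difference bound leaves a lower bound at
    \<open>y\<close> itself.\<close>
  have lo: "F y \<ge> F x + D x * (y - x) - K * (y - x)\<^sup>2" for x y
    using semi[of x "y - x"] up[of "x - (y - x)" x] by (simp add: algebra_simps)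
  have K0: "K \<ge> 0"
    using up[of 1 0] lo[of 0 1] by simp
  have der: "(F has_real_derivative D x) (at x within S)" for x
  proof -
    have "((\<lambda>y. (F y - F x) / (y - x) - D x) \<longlongrightarrow> 0) (at x)"
    proof (rule Lim_null_comparison)
      show "\<forall>\<^sub>F y in at x. norm ((F y - F x) / (y - x) - D x) \<le> K * \<bar>y - x\<bar>"
      proof (rule eventually_at_filter[THEN iffD2], rule always_eventually, intro allI impI)
        fix y assume "y \<noteq> x"
        have "(F y - F x) / (y - x) - D x = (F y - F x - D x * (y - x)) / (y - x)"
          using \<open>y \<noteq> x\<close> by (simp add: field_simps)
        moreover have "\<bar>F y - F x - D x * (y - x)\<bar> \<le> K * (y - x)\<^sup>2"
          using up[of y x] lo[of x y] K0 by (simp add: abs_le_iff)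
        moreover have "K * (y - x)\<^sup>2 = K * \<bar>y - x\<bar> * \<bar>y - x\<bar>"
          by (simp add: power2_eq_square)
        ultimately show "norm ((F y - F x) / (y - x) - D x) \<le> K * \<bar>y - x\<bar>"
          using \<open>y \<noteq> x\<close> by (simp add: abs_divide divide_le_eq)
      qed
      show "((\<lambda>y. K * \<bar>y - x\<bar>) \<longlongrightarrow> 0) (at x)"
        by (auto intro!: tendsto_eq_intros)
    qed
    then have "((\<lambda>y. (F y - F x) / (y - x)) \<longlongrightarrow> D x) (at x)"
      by (simp add: Lim_null[symmetric])
    then have "(F has_real_derivative D x) (at x)"
      by (simp add: has_field_derivative_iff)
    then show ?thesis
      by (rule has_field_derivative_at_within)
  qed
  have lip1: "\<bar>D x - D y\<bar> \<le> 4 * K * (y - x)" if "x < y" for x y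
  proof -
    define h where "h = y - x"
    have h: "h > 0" "y = x + h"
      using that by (auto simp: h_def)
    \<comment> \<open>The lower bound based at \<open>x\<close> and the upper bound based at
      \<open>y\<close> are compared at the point \<open>2 * h\<close> away from \<open>x\<close>;
      this is the source of the factor 4.\<close>
    have a: "F (x + 2 * h) \<ge> F x + D x * (2 * h) - K * (2 * h)\<^sup>2"
      using lo[of x "x + 2 * h"] by simp
    have b: "F (x + 2 * h) \<le> F y + D y * h"
      using up[of "x + 2 * h" y] h by simp
    have c: "F y \<le> F x + D x * h"
      using up[of y x] h by simp
    have "(D x - D y) * h \<le> (4 * K * h) * h"
      using a b c by (simp add: algebra_simps power2_eq_square)
    moreover have "(D x - D y) * h \<ge> 0"
    proof -
      have "F x \<le> F y - D y * h"
        using up[of x y] h by simp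
      with c show ?thesis
        by (simp add: algebra_simps)
    qed
    ultimately have "D x - D y \<le> 4 * K * h" "D x - D y \<ge> 0"
      using h(1) by (auto simp: zero_le_mult_iff)
    then show ?thesis
      by (simp add: h_def)
  qed
  have "\<bar>D x - D y\<bar> \<le> 4 * K * \<bar>x - y\<bar>" for x y
    using lip1[of x y] lip1[of y x] by (cases x y rule: linorder_cases) (auto simp: abs_minus_commute)
  then have "(4 * K)-lipschitz_on S D"
    using K0 by (auto simp: lipschitz_on_def dist_real_def)
  with der show ?thesis
    unfolding C11_on_def by blast
qed

section \<open>Null boundaries and supports\<close>

text \<open>The complement of \<open>spt f\<close> is a union of possibly uncountably many open sets
  on which \<open>f\<close> vanishes a.e.; the Lindelof property reduces it to a countable
  union.\<close>

lemma AE_zero_outside_spt: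
  fixes f :: "'a::euclidean_space \<Rightarrow> real"
  shows "AE x in lebesgue. x \<notin> spt f \<longrightarrow> f x = 0"
proof -
  define \<F> where "\<F> = uminus ` {K. closed K \<and> (AE x in lebesgue. x \<notin> K \<longrightarrow> f x = 0)}"
  obtain \<G> where \<G>: "\<G> \<subseteq> \<F>" "countable \<G>" "\<Union>\<G> = \<Union>\<F>"
    by (rule Lindelof[of \<F>]) (auto simp: \<F>_def)
  have "AE x in lebesgue. \<forall>U\<in>\<G>. x \<in> U \<longrightarrow> f x = 0"
    by (subst AE_ball_countable[OF \<G>(2)]) (use \<G>(1) in \<open>auto simp: \<F>_def\<close>)
  moreover have "- spt f = \<Union>\<G>"
    unfolding \<G>(3) spt_def \<F>_def by auto
  then have "x \<notin> spt f \<longleftrightarrow> (\<exists>U\<in>\<G>. x \<in> U)" for x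
    by blast
  ultimately show ?thesis
    by (auto elim!: eventually_mono)
qed

text \<open>From a point \<open>a\<close> lying behind \<open>p\<close> in a direction of increase,
  \<open>\<rho>\<close> is strictly increasing along the part of each ray that runs in a small ball
  around \<open>p\<close>. Each ray thus meets the zero set at most once, and the negligibility
  criterion for starlike sets applies.\<close>

lemma negligible_level_set:
  fixes \<rho> :: "'a::euclidean_space \<Rightarrow> real"
  assumes "open U" "p \<in> U" and C1: "C_k_on (Suc 0) \<rho> U"
    and nz: "frechet_derivative \<rho> (at p) \<noteq> (\<lambda>v. 0)"
  shows "\<exists>r>0. negligible {x \<in> cball p r. \<rho> x = 0}"
proof -
  define D where "D x = frechet_derivative \<rho> (at x)" for x
  have D: "(\<rho> has_derivative D x) (at x)" if "x \<in> U" for x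
    using C1 that by (auto simp: D_def frechet_derivative_works)
  have lin: "linear (D x)" if "x \<in> U" for x
    using D[OF that] has_derivative_linear by blast
  have contb: "continuous_on U (\<lambda>x. D x b)" if "b \<in> Basis" for b
    using C1 that by (auto simp: D_def)
  have Dsum: "D x v = (\<Sum>b\<in>Basis. (v \<bullet> b) * D x b)" if "x \<in> U" for x v
  proof -
    have "D x v = D x (\<Sum>b\<in>Basis. (v \<bullet> b) *\<^sub>R b)"
      by (simp add: euclidean_representation)
    also have "\<dots> = (\<Sum>b\<in>Basis. (v \<bullet> b) * D x b)"
      by (simp add: linear_sum[OF lin[OF that]] linear_scale[OF lin[OF that]])
    finally show ?thesis .
  qed
  obtain v where v: "D p v > 0"
  proof -
    obtain v where "D p v \<noteq> 0"
      using nz by (auto simp: D_def)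
    then show ?thesis
      using that[of v] that[of "- v"] linear_neg[OF lin[OF \<open>p \<in> U\<close>], of v] by force
  qed
  \<comment> \<open>Now \<open>p - a = v\<close>, so \<open>D x (x - a)\<close> is positive at
    \<open>p\<close>, and by continuity of the partial derivatives also near
    \<open>p\<close>.\<close>
  define a where "a = p - v"
  have "continuous_on U (\<lambda>x. \<Sum>b\<in>Basis. ((x - a) \<bullet> b) * D x b)"
    by (intro continuous_intros contb)
  then have "continuous_on U (\<lambda>x. D x (x - a))"
    by (rule continuous_on_eq) (simp add: Dsum)
  then have "isCont (\<lambda>x. D x (x - a)) p"
    using \<open>open U\<close> \<open>p \<in> U\<close> by (simp add: continuous_on_eq_continuous_at)
  then have "\<forall>\<^sub>F x in at p. D x (x - a) > 0"
    using v by (intro order_tendstoD(1)[of _ "D p (p - a)"]) (auto simp: isCont_def a_def)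
  then obtain S where "open S" "p \<in> S" "\<forall>x\<in>S. x \<noteq> p \<longrightarrow> D x (x - a) > 0"
    unfolding eventually_at_topological by blast
  then have S: "open (S \<inter> U)" "p \<in> S \<inter> U" "\<And>x. x \<in> S \<inter> U \<Longrightarrow> D x (x - a) > 0"
    using v \<open>open U\<close> \<open>p \<in> U\<close> by (auto simp: a_def)
  then obtain r where r: "r > 0" "cball p r \<subseteq> S \<inter> U"
    by (meson open_contains_cball)
  have "a \<noteq> p"
    using v linear_0[OF lin[OF \<open>p \<in> U\<close>]] by (auto simp: a_def)
  \<comment> \<open>The radius also keeps \<open>a\<close> out of the ball, so that the ray
    parameter is positive there and can be cancelled.\<close>
  define q where "q = min r (dist a p / 2)"
  have q: "q > 0" "cball p q \<subseteq> S \<inter> U" "a \<notin> cball p q"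
    using r \<open>a \<noteq> p\<close> by (auto simp: q_def subset_iff dist_commute)
  define L where "L = {x \<in> cball p q. \<rho> x = 0}"
  have cont: "continuous_on (cball p q) \<rho>"
    by (rule has_derivative_continuous_on[of _ _ D]) (use D q(2) has_derivative_at_withinI in blast)
  have "closed L"
  proof -
    have "closed (cball p q \<inter> \<rho> -` {0})"
      by (rule continuous_closed_preimage[OF cont]) auto
    moreover have "cball p q \<inter> \<rho> -` {0} = L"
      by (auto simp: L_def)
    ultimately show ?thesis
      by simp
  qed
  have "negligible L"
  proof (rule starlike_negligible_strong[OF \<open>closed L\<close>, of a])
    fix c :: real and x
    assume c: "0 \<le> c" "c < 1" and x: "a + x \<in> L"
    show "a + c *\<^sub>R x \<notin> L"
    proof
      assume cx: "a + c *\<^sub>R x \<in> L"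
      then have "c > 0"
        using c q(3) by (cases "c = 0") (auto simp: L_def)
      define \<phi> where "\<phi> t = \<rho> (a + t *\<^sub>R x)" for t
      have inb: "a + t *\<^sub>R x \<in> cball p q" if "c \<le> t" "t \<le> 1" for t
      proof -
        define u where "u = (1 - t) / (1 - c)"
        have u: "0 \<le> u" "u \<le> 1" and "u * (1 - c) = 1 - t"
          using that c by (auto simp: u_def)
        then have u3: "u * c + (1 - u) = t"
          by (simp add: algebra_simps)
        have "u *\<^sub>R (a + c *\<^sub>R x) + (1 - u) *\<^sub>R (a + x) \<in> cball p q"
          using cx x u by (intro convexD[OF convex_cball]) (auto simp: L_def)
        moreover have "u *\<^sub>R (a + c *\<^sub>R x) + (1 - u) *\<^sub>R (a + x) = a + (u * c + (1 - u)) *\<^sub>R x"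
          by (simp add: algebra_simps)
        ultimately show ?thesis
          using u3 by simp
      qed
      have "\<phi> c < \<phi> 1"
      proof (rule DERIV_pos_imp_increasing[OF c(2)])
        fix t assume t: "c \<le> t" "t \<le> 1"
        define z where "z = a + t *\<^sub>R x"
        have z: "z \<in> S \<inter> U"
          using inb[OF t] q(2) by (auto simp: z_def)
        have "((\<lambda>t. a + t *\<^sub>R x) has_derivative (\<lambda>h. h *\<^sub>R x)) (at t)"
          by (auto intro!: derivative_eq_intros)
        then have "(\<phi> has_derivative (\<lambda>h. D z (h *\<^sub>R x))) (at t)"
          unfolding \<phi>_def using D[of z] z by (auto intro: has_derivative_compose simp: z_def)
        then have "(\<phi> has_real_derivative D z x) (at t)"
          using z by (simp add: has_field_derivative_def linear_scale[OF lin] mult.commute[of _ "D z x"])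
        \<comment> \<open>This is \<open>D z (z - a) > 0\<close>, because
          \<open>z - a = t *\<^sub>R x\<close>.\<close>
        moreover have "t * D z x > 0"
          using S(3)[OF z] z linear_scale[OF lin, of z t x] by (simp add: z_def)
        then have "D z x > 0"
          using t \<open>c > 0\<close> by (simp add: zero_less_mult_iff)
        ultimately show "\<exists>y. (\<phi> has_real_derivative y) (at t) \<and> 0 < y"
          by blast
      qed
      moreover have "\<phi> c = 0" "\<phi> 1 = 0"
        using cx x by (auto simp: \<phi>_def L_def)
      ultimately show False
        by simp
    qed
  qed
  with q(1) show ?thesis
    unfolding L_def by blast
qed

text \<open>Near a frontier point the frontier lies in the zero set of the defining function: a
  negative value would put the point into the open set \<open>S\<close>, a positive one away from
  its closure.\<close>

lemma negligible_frontier_smooth: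
  assumes "open S" "smooth_boundary S"
  shows "negligible (frontier S)"
proof (rule locally_negligible_alt[THEN iffD2], rule ballI)
  fix p assume p: "p \<in> frontier S"
  then obtain U \<rho> where U: "open U" "p \<in> U" "smooth_on \<rho> U"
      "\<forall>x\<in>U. frechet_derivative \<rho> (at x) \<noteq> (\<lambda>v. 0)" "S \<inter> U = {x\<in>U. \<rho> x < 0}"
    using assms(2) unfolding smooth_boundary_def by blast
  have C1: "C_k_on (Suc 0) \<rho> U" and cont: "continuous_on U \<rho>"
    using U(3) unfolding smooth_on_def by (metis C_k_on.simps(1))+
  obtain r where r: "r > 0" "negligible {x \<in> cball p r. \<rho> x = 0}"
    using negligible_level_set[OF U(1,2) C1] U(2,4) by blast
  have zero: "\<rho> x = 0" if x: "x \<in> frontier S" "x \<in> U" for x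
  proof (rule antisym)
    show "\<rho> x \<ge> 0"
      using x U(5) assms(1) by (force simp: frontier_def interior_open)
    show "\<rho> x \<le> 0"
    proof (rule ccontr)
      assume "\<not> \<rho> x \<le> 0"
      then have "x \<in> (U \<inter> \<rho> -` {0<..}) \<inter> closure S"
        using x by (auto simp: frontier_def)
      moreover have "open (U \<inter> \<rho> -` {0<..})"
        by (rule continuous_open_preimage[OF cont U(1)]) simp
      ultimately have "(U \<inter> \<rho> -` {0<..}) \<inter> S \<noteq> {}"
        using open_Int_closure_eq_empty by blast
      then obtain y where "y \<in> S \<inter> U" "\<rho> y > 0"
        by auto
      then show False
        unfolding U(5) by simp
    qed
  qed
  show "\<exists>V. openin (top_of_set (frontier S)) V \<and> p \<in> V \<and> negligible V"
  proof (intro exI conjI)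
    show "openin (top_of_set (frontier S)) (frontier S \<inter> (U \<inter> ball p r))"
      using U(1) by (simp add: openin_open_Int open_Int)
    show "p \<in> frontier S \<inter> (U \<inter> ball p r)"
      using p U(2) r(1) by auto
    show "negligible (frontier S \<inter> (U \<inter> ball p r))"
      by (rule negligible_subset[OF r(2)]) (use zero in auto)
  qed
qed

section \<open>Sums of measures\<close>

definition plus_measure :: "'a measure \<Rightarrow> 'a measure \<Rightarrow> 'a measure" where
  "plus_measure M N = measure_of (space M) (sets M) (\<lambda>A. emeasure M A + emeasure N A)"

lemma
  assumes "sets N = sets M"
  shows sets_plus_measure: "sets (plus_measure M N) = sets M"
    and space_plus_measure: "space (plus_measure M N) = space M"
    and emeasure_plus_measure:
      "A \<in> sets M \<Longrightarrow> emeasure (plus_measure M N) A = emeasure M A + emeasure N A"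
proof -
  show s: "sets (plus_measure M N) = sets M"
    unfolding plus_measure_def by simp
  show "space (plus_measure M N) = space M"
    unfolding plus_measure_def by simp
  assume A: "A \<in> sets M"
  show "emeasure (plus_measure M N) A = emeasure M A + emeasure N A"
  proof (rule emeasure_measure_of[OF plus_measure_def])
    show "positive (sets (plus_measure M N)) (\<lambda>A. emeasure M A + emeasure N A)"
      by (simp add: positive_def)
    show "countably_additive (sets (plus_measure M N)) (\<lambda>A. emeasure M A + emeasure N A)"
    proof (rule countably_additiveI)
      fix B :: "nat \<Rightarrow> _"
      assume B: "range B \<subseteq> sets (plus_measure M N)" "disjoint_family B"
      then have "range B \<subseteq> sets M" "range B \<subseteq> sets N"
        using s assms by auto
      then show "(\<Sum>i. emeasure M (B i) + emeasure N (B i)) = emeasure M (\<Union>(range B)) + emeasure N (\<Union>(range B))"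
        using B(2) by (simp add: suminf_add[symmetric] suminf_emeasure)
    qed
  qed (use A sets.space_closed s in auto)
qed

lemma nn_integral_plus_measure:
  assumes sN: "sets N = sets M" and f: "f \<in> borel_measurable M"
  shows "(\<integral>\<^sup>+x. f x \<partial>plus_measure M N) = (\<integral>\<^sup>+x. f x \<partial>M) + (\<integral>\<^sup>+x. f x \<partial>N)"
  using f
proof (induct rule: borel_measurable_induct)
  case (cong f g)
  have "space N = space M"
    using sN by (rule sets_eq_imp_space_eq)
  with cong show ?case
    by (simp add: space_plus_measure[OF sN] cong: nn_integral_cong_simp)
next
  case (set A)
  then show ?case
    using sN by (simp add: sets_plus_measure emeasure_plus_measure)
next
  case (mult u c)
  then have "u \<in> borel_measurable N" "u \<in> borel_measurable (plus_measure M N)"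
    using sN sets_plus_measure[OF sN] by (auto cong: measurable_cong_sets)
  with mult show ?case
    by (simp add: nn_integral_cmult distrib_left)
next
  case (add u v)
  then have "u \<in> borel_measurable N" "u \<in> borel_measurable (plus_measure M N)"
    "v \<in> borel_measurable N" "v \<in> borel_measurable (plus_measure M N)"
    using sN sets_plus_measure[OF sN] by (auto cong: measurable_cong_sets)
  with add show ?case
    by (simp add: nn_integral_add ac_simps)
next
  case (seq U)
  then have m: "U i \<in> borel_measurable N" "U i \<in> borel_measurable (plus_measure M N)" for i
    using sN sets_plus_measure[OF sN] by (auto cong: measurable_cong_sets)
  have inc: "incseq (\<lambda>i. integral\<^sup>N L (U i))" for L
    using \<open>incseq U\<close> unfolding incseq_def le_fun_def by (auto intro!: nn_integral_mono)
  show ?case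
    using seq m inc
    by (simp add: nn_integral_monotone_convergence_SUP image_comp ennreal_SUP_add)
qed

section \<open>Exchange along tubes\<close>

lemma borel_measurable_nth_vec [measurable]: "(\<lambda>x::real^'n. x $ j) \<in> borel_measurable borel"
  by (intro borel_measurable_continuous_onI continuous_intros)

text \<open>The box sizes \<open>a\<close> are small in the coordinates other than \<open>i\<close>, so the boxes are tubes in
  direction \<open>s e\<^sub>i\<close>.\<close>

locale tube_exchange =
  fixes \<theta> :: "((real^'n) \<times> (real^'n)) measure" and i :: 'n and s :: real and a :: "'n \<Rightarrow> real"
  assumes finite_\<theta>: "finite_measure \<theta>"
    and sets_\<theta>: "sets \<theta> = sets borel"
    and s_cases: "s = 1 \<or> s = -1"
    and a_pos: "\<And>j. a j > 0"
begin

text \<open>The classes are the cells of a half-open grid with side lengths \<open>a j\<close>, so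
  they partition the space; in direction \<open>i\<close> the tubes are cut into pieces of length
  \<open>a i\<close>.\<close>

definition same :: "real^'n \<Rightarrow> real^'n \<Rightarrow> bool" where
  "same x z \<longleftrightarrow> (\<forall>j. \<lfloor>x$j / a j\<rfloor> = \<lfloor>z$j / a j\<rfloor>)"

definition \<kappa> :: "(real^'n) measure" where
  "\<kappa> = distr \<theta> borel fst"

definition q :: "real^'n \<Rightarrow> real" where
  "q x = measure \<kappa> {z. same x z}"

text \<open>The exchange kernel: mass starting at \<open>x\<close> is moved to points \<open>z\<close> of the same tube that lie
  further ahead, in proportion to \<open>\<kappa>\<close>. Moving it this way, no point gives away or receives more
  than its own \<open>\<kappa>\<close>-mass. If \<open>q x = 0\<close> then \<open>r x z = 0\<close>.\<close>

definition r :: "real^'n \<Rightarrow> real^'n \<Rightarrow> real" where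
  "r x z = (if same x z \<and> s * x$i < s * z$i then 1 / q x else 0)"

text \<open>This is the total mass of the kernel \<open>r x\<close> against \<open>\<kappa>\<close>,
  that is, the fraction of the mass starting at \<open>x\<close> that is moved.\<close>

definition \<rho> :: "real^'n \<Rightarrow> real" where
  "\<rho> x = measure \<kappa> {z. same x z \<and> s * x$i < s * z$i} / q x"

text \<open>The plan of the moved mass: a pair \<open>(x, y)\<close> of \<open>\<theta>\<close> is
  spread over pairs \<open>(z, y)\<close> with density \<open>r x z\<close> in \<open>z\<close>
  against \<open>\<kappa>\<close>, keeping its endpoint.\<close>

definition \<xi> :: "((real^'n) \<times> (real^'n)) measure" where
  "\<xi> = distr (density (\<theta> \<Otimes>\<^sub>M \<kappa>) (\<lambda>p. ennreal (r (fst (fst p)) (snd p)))) borel (\<lambda>p. (snd p, snd (fst p)))"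

section \<open>Measurability and marginals of the exchange\<close>

lemma same_refl [simp]: "same x x"
  and same_sym: "same x z \<longleftrightarrow> same z x"
  by (auto simp: same_def)

lemma sets_\<theta>' [measurable_cong]: "sets \<theta> = sets (borel \<Otimes>\<^sub>M borel)"
  unfolding borel_prod by (rule sets_\<theta>)

lemma sets_\<kappa> [measurable_cong, simp]: "sets \<kappa> = sets borel"
  by (simp add: \<kappa>_def)

lemma space_\<kappa> [simp]: "space \<kappa> = UNIV"
  by (simp add: \<kappa>_def)

lemma space_\<theta> [simp]: "space \<theta> = UNIV"
  using sets_eq_imp_space_eq[OF sets_\<theta>] by simp

lemma fst_measurable_\<theta> [measurable]: "fst \<in> measurable \<theta> borel"
  by measurable

sublocale \<theta>: finite_measure \<theta>
  by (rule finite_\<theta>)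

sublocale \<kappa>: finite_measure \<kappa>
  unfolding \<kappa>_def by (rule \<theta>.finite_measure_distr) measurable

lemma same_measurable [measurable]: "Measurable.pred (borel \<Otimes>\<^sub>M borel) (\<lambda>p. same (fst p) (snd p))"
  unfolding same_def by measurable

lemma sets_same [measurable]: "{z. same x z} \<in> sets borel"
proof -
  have "Measurable.pred borel (same x)"
    unfolding same_def by measurable
  then show ?thesis
    by simp
qed

lemma sets_same_less [measurable]: "{z. same x z \<and> s * x$i < s * z$i} \<in> sets borel"
proof -
  have "Measurable.pred borel (\<lambda>z. same x z \<and> s * x$i < s * z$i)"
    unfolding same_def by measurable
  then show ?thesis
    by simp
qed

lemma q_measurable [measurable]: "q \<in> borel_measurable borel"
proof -
  have "{p. same (fst p) (snd p)} \<in> sets (borel \<Otimes>\<^sub>M \<kappa>)"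
    using predE[OF same_measurable] by (simp add: space_pair_measure sets_pair_measure_cong[OF refl sets_\<kappa>])
  from \<kappa>.measurable_emeasure_Pair[OF this]
  show ?thesis
    by (simp add: q_def[abs_def] measure_def vimage_def)
qed

lemma \<rho>_measurable [measurable]: "\<rho> \<in> borel_measurable borel"
proof -
  have *: "Measurable.pred (borel \<Otimes>\<^sub>M borel) (\<lambda>p. same (fst p) (snd p) \<and> s * fst p $ i < s * snd p $ i)"
    by measurable
  have "{p. same (fst p) (snd p) \<and> s * fst p $ i < s * snd p $ i} \<in> sets (borel \<Otimes>\<^sub>M \<kappa>)"
    using predE[OF *] by (simp add: space_pair_measure sets_pair_measure_cong[OF refl sets_\<kappa>])
  from \<kappa>.measurable_emeasure_Pair[OF this]
  have "(\<lambda>x. measure \<kappa> {z. same x z \<and> s * x$i < s * z$i}) \<in> borel_measurable borel"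
    by (simp add: measure_def vimage_def)
  then show ?thesis
    unfolding \<rho>_def[abs_def] by measurable
qed

lemma r_measurable [measurable]: "(\<lambda>p. r (fst p) (snd p)) \<in> borel_measurable (borel \<Otimes>\<^sub>M borel)"
  unfolding r_def by measurable

lemma r_measurable' [measurable (raw)]:
  assumes [measurable]: "f \<in> measurable M borel" "g \<in> measurable M borel"
  shows "(\<lambda>p. r (f p) (g p)) \<in> borel_measurable M"
  using measurable_compose[OF _ r_measurable, of "\<lambda>p. (f p, g p)" M] by simp

lemma q_nonneg: "q x \<ge> 0"
  by (simp add: q_def)

lemma r_nonneg: "r x z \<ge> 0"
  by (simp add: r_def q_nonneg)

lemma q_cong: "same x z \<Longrightarrow> q x = q z"
  unfolding q_def same_def by simp

lemma \<rho>_nonneg: "\<rho> x \<ge> 0" and \<rho>_le_1: "\<rho> x \<le> 1"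
proof -
  show "\<rho> x \<ge> 0"
    by (simp add: \<rho>_def q_nonneg)
  have "measure \<kappa> {z. same x z \<and> s * x$i < s * z$i} \<le> q x"
    unfolding q_def by (rule \<kappa>.finite_measure_mono) auto
  then show "\<rho> x \<le> 1"
    unfolding \<rho>_def using q_nonneg[of x] by (simp add: divide_le_eq)
qed

lemma nn_integral_r: "(\<integral>\<^sup>+z. r x z \<partial>\<kappa>) = \<rho> x"
proof -
  have "(\<integral>\<^sup>+z. r x z \<partial>\<kappa>) = (\<integral>\<^sup>+z. ennreal (1 / q x) * indicator {z. same x z \<and> s * x$i < s * z$i} z \<partial>\<kappa>)"
    by (intro nn_integral_cong) (simp add: r_def indicator_def)
  also have "\<dots> = ennreal (1 / q x) * emeasure \<kappa> {z. same x z \<and> s * x$i < s * z$i}"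
    by (simp add: nn_integral_cmult_indicator)
  also have "\<dots> = \<rho> x"
    unfolding \<rho>_def by (simp add: \<kappa>.emeasure_eq_measure q_nonneg flip: ennreal_mult)
  finally show ?thesis .
qed

text \<open>\<open>q\<close> is constant on cells, so the normalization by the cell of the source is
  also one by the cell of the target, and the sources of \<open>z\<close> lie in that cell.\<close>

lemma nn_integral_r_fst_le: "(\<integral>\<^sup>+x. r x z \<partial>\<kappa>) \<le> 1"
proof -
  have "(\<integral>\<^sup>+x. r x z \<partial>\<kappa>) \<le> (\<integral>\<^sup>+x. ennreal (1 / q z) * indicator {x. same z x} x \<partial>\<kappa>)"
    by (intro nn_integral_mono) (auto simp: r_def indicator_def same_sym[of z] q_nonneg dest: q_cong)
  also have "\<dots> = ennreal (1 / q z) * emeasure \<kappa> {x. same z x}"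
    by (simp add: nn_integral_cmult_indicator)
  also have "\<dots> = ennreal (1 / q z * q z)"
    unfolding q_def by (simp add: \<kappa>.emeasure_eq_measure flip: ennreal_mult)
  \<comment> \<open>For \<open>q z = 0\<close> the product is 0 by the convention on division,
    otherwise it is 1.\<close>
  also have "\<dots> \<le> 1"
    by simp
  finally show ?thesis .
qed

lemma nn_integral_\<theta>_fst:
  assumes [measurable]: "h \<in> borel_measurable borel"
  shows "(\<integral>\<^sup>+p. h (fst p) \<partial>\<theta>) = (\<integral>\<^sup>+x. h x \<partial>\<kappa>)"
  unfolding \<kappa>_def by (simp add: nn_integral_distr)

lemma sets_\<xi> [simp, measurable_cong]: "sets \<xi> = sets borel"
  by (simp add: \<xi>_def)

lemma nn_integral_\<xi>:
  assumes h [measurable]: "h \<in> borel_measurable (borel \<Otimes>\<^sub>M borel)"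
  shows "(\<integral>\<^sup>+p. h p \<partial>\<xi>) = (\<integral>\<^sup>+p. (\<integral>\<^sup>+z. ennreal (r (fst p) z) * h (z, snd p) \<partial>\<kappa>) \<partial>\<theta>)"
proof -
  have [measurable]: "(\<lambda>p. (snd p, snd (fst p))) \<in> measurable (\<theta> \<Otimes>\<^sub>M \<kappa>) (borel :: ((real^'n) \<times> (real^'n)) measure)"
    unfolding borel_prod[symmetric] by measurable
  have [measurable]: "h \<in> borel_measurable borel"
    using h unfolding borel_prod .
  have "(\<integral>\<^sup>+p. h p \<partial>\<xi>) = (\<integral>\<^sup>+p. ennreal (r (fst (fst p)) (snd p)) * h (snd p, snd (fst p)) \<partial>(\<theta> \<Otimes>\<^sub>M \<kappa>))"
    unfolding \<xi>_def
    by (simp add: nn_integral_distr nn_integral_density)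
  also have "\<dots> = (\<integral>\<^sup>+p. (\<integral>\<^sup>+z. ennreal (r (fst p) z) * h (z, snd p) \<partial>\<kappa>) \<partial>\<theta>)"
    by (subst \<kappa>.nn_integral_fst[symmetric]) auto
  finally show ?thesis .
qed

lemma pair_sigma_finite_\<theta>\<kappa>: "pair_sigma_finite \<theta> \<kappa>"
  unfolding pair_sigma_finite_def by (intro conjI) unfold_locales

text \<open>Fubini exchanges source and target: the mass arriving in \<open>A\<close> is an integral
  over targets in \<open>A\<close> of what they receive, which is at most 1 per unit of
  \<open>\<kappa>\<close>.\<close>

lemma \<xi>_fst_le:
  assumes [measurable]: "A \<in> sets borel"
  shows "emeasure \<xi> (A \<times> UNIV) \<le> emeasure \<kappa> A"
proof -
  interpret pair_sigma_finite \<theta> \<kappa>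
    by (rule pair_sigma_finite_\<theta>\<kappa>)
  have A: "A \<times> UNIV \<in> sets (borel \<Otimes>\<^sub>M (borel :: (real^'n) measure))"
    by measurable
  have "emeasure \<xi> (A \<times> UNIV) = (\<integral>\<^sup>+p. indicator (A \<times> UNIV) p \<partial>\<xi>)"
    using A[unfolded borel_prod] by simp
  also have "\<dots> = (\<integral>\<^sup>+p. (\<integral>\<^sup>+z. ennreal (r (fst p) z) * indicator A z \<partial>\<kappa>) \<partial>\<theta>)"
    using A by (subst nn_integral_\<xi>) (auto simp: indicator_def)
  also have "\<dots> = (\<integral>\<^sup>+z. (\<integral>\<^sup>+p. ennreal (r (fst p) z) * indicator A z \<partial>\<theta>) \<partial>\<kappa>)"
    by (rule Fubini'[symmetric]) measurable
  also have "\<dots> = (\<integral>\<^sup>+z. (\<integral>\<^sup>+x. ennreal (r x z) * indicator A z \<partial>\<kappa>) \<partial>\<kappa>)"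
    by (intro nn_integral_cong nn_integral_\<theta>_fst) measurable
  also have "\<dots> = (\<integral>\<^sup>+z. (\<integral>\<^sup>+x. ennreal (r x z) \<partial>\<kappa>) * indicator A z \<partial>\<kappa>)"
    by (intro nn_integral_cong nn_integral_multc) measurable
  also have "\<dots> \<le> (\<integral>\<^sup>+z. 1 * indicator A z \<partial>\<kappa>)"
    by (intro nn_integral_mono mult_right_mono nn_integral_r_fst_le) auto
  also have "\<dots> = emeasure \<kappa> A"
    by simp
  finally show ?thesis .
qed

text \<open>Endpoints are kept, so integrating out the target leaves only the moved fraction
  \<open>\<rho>\<close>.\<close>

lemma \<xi>_snd:
  assumes [measurable]: "A \<in> sets borel"
  shows "emeasure \<xi> (UNIV \<times> A) = (\<integral>\<^sup>+p. ennreal (\<rho> (fst p)) * indicator (UNIV \<times> A) p \<partial>\<theta>)"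
proof -
  have A: "UNIV \<times> A \<in> sets ((borel :: (real^'n) measure) \<Otimes>\<^sub>M borel)"
    by measurable
  have "emeasure \<xi> (UNIV \<times> A) = (\<integral>\<^sup>+p. indicator (UNIV \<times> A) p \<partial>\<xi>)"
    using A[unfolded borel_prod] by simp
  also have "\<dots> = (\<integral>\<^sup>+p. (\<integral>\<^sup>+z. ennreal (r (fst p) z) * indicator (UNIV \<times> A) p \<partial>\<kappa>) \<partial>\<theta>)"
    using A by (subst nn_integral_\<xi>) (auto simp: indicator_def intro!: nn_integral_cong)
  also have "\<dots> = (\<integral>\<^sup>+p. (\<integral>\<^sup>+z. ennreal (r (fst p) z) \<partial>\<kappa>) * indicator (UNIV \<times> A) p \<partial>\<theta>)"
    by (intro nn_integral_cong nn_integral_multc) measurable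
  finally show ?thesis
    by (simp add: nn_integral_r)
qed


section \<open>Lower bound for the forward displacement\<close>

lemma same_nth: "same x z \<Longrightarrow> \<bar>x$j - z$j\<bar> \<le> a j"
proof -
  assume "same x z"
  then have "\<lfloor>x$j / a j\<rfloor> = \<lfloor>z$j / a j\<rfloor>"
    by (simp add: same_def)
  then have "\<bar>x$j / a j - z$j / a j\<bar> < 1"
    by linarith
  then show ?thesis
    using a_pos[of j] by (simp add: diff_divide_distrib[symmetric] abs_divide divide_less_eq)
qed

text \<open>The cross section of a tube, orthogonal to direction \<open>i\<close>.\<close>

definition v :: real where
  "v = (\<Prod>j\<in>UNIV - {i}. a j)"

lemma v_pos: "v > 0"
  unfolding v_def by (intro prod_pos) (simp add: a_pos)

lemma slab_measurable [measurable]: "{z. same x z \<and> \<bar>x$i - z$i\<bar> \<le> l} \<in> sets borel"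
proof -
  have "Measurable.pred borel (\<lambda>z. same x z \<and> \<bar>x$i - z$i\<bar> \<le> l)"
    unfolding same_def by measurable
  then show ?thesis
    by simp
qed

lemma slab_volume:
  assumes "l \<ge> 0"
  shows "emeasure lborel {z. same x z \<and> \<bar>x$i - z$i\<bar> \<le> l} \<le> ennreal (2 * l * v)"
proof -
  define lo where "lo = (\<chi> j. if j = i then x$i - l else a j * of_int \<lfloor>x$j / a j\<rfloor>)"
  define hi where "hi = (\<chi> j. if j = i then x$i + l else a j * (of_int \<lfloor>x$j / a j\<rfloor> + 1))"
  have sub: "{z. same x z \<and> \<bar>x$i - z$i\<bar> \<le> l} \<subseteq> cbox lo hi"
  proof
    fix z assume z: "z \<in> {z. same x z \<and> \<bar>x$i - z$i\<bar> \<le> l}"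
    have "lo$j \<le> z$j \<and> z$j \<le> hi$j" for j
    proof (cases "j = i")
      case True
      then show ?thesis
        using z by (auto simp: lo_def hi_def)
    next
      case False
      have "\<lfloor>x$j / a j\<rfloor> = \<lfloor>z$j / a j\<rfloor>"
        using z by (simp add: same_def)
      then have "of_int \<lfloor>x$j / a j\<rfloor> \<le> z$j / a j" "z$j / a j \<le> of_int \<lfloor>x$j / a j\<rfloor> + 1"
        by linarith+
      then show ?thesis
        using a_pos[of j] False by (simp add: lo_def hi_def field_simps)
    qed
    then show "z \<in> cbox lo hi"
      by (simp add: mem_box_cart)
  qed
  have ne: "lo$j \<le> hi$j" for j
    using assms a_pos[of j] by (simp add: lo_def hi_def algebra_simps)
  have "emeasure lborel {z. same x z \<and> \<bar>x$i - z$i\<bar> \<le> l} \<le> emeasure lborel (cbox lo hi)"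
    by (rule emeasure_mono[OF sub]) simp
  also have "\<dots> = ennreal (measure lborel (cbox lo hi))"
    by (rule emeasure_eq_ennreal_measure) (simp add: emeasure_lborel_cbox_eq)
  also have "measure lborel (cbox lo hi) = (\<Prod>j\<in>UNIV. hi$j - lo$j)"
    using ne by (intro content_cbox_cart) (simp add: interval_ne_empty_cart)
  also have "\<dots> = (hi$i - lo$i) * (\<Prod>j\<in>UNIV - {i}. hi$j - lo$j)"
    by (rule prod.remove) auto
  also have "\<dots> = 2 * l * v"
  proof -
    have "(\<Prod>j\<in>UNIV - {i}. hi$j - lo$j) = v"
      unfolding v_def by (rule prod.cong) (auto simp: lo_def hi_def algebra_simps)
    then show ?thesis
      by (simp add: lo_def hi_def)
  qed
  finally show ?thesis .
qed

text \<open>A measure with density at most \<open>\<beta>\<close> cannot concentrate on a thin slab: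
  half of the mass of the cell has distance more than a length \<open>l\<close> of order
  \<open>q x / (\<beta> * v)\<close> from \<open>x\<close> in direction \<open>i\<close>.\<close>

lemma spread_lower_bound:
  assumes \<beta>: "\<beta> > 0" "\<And>A. A \<in> sets borel \<Longrightarrow> emeasure \<kappa> A \<le> ennreal \<beta> * emeasure lborel A"
  shows "ennreal ((q x)\<^sup>2 / (8 * \<beta> * v)) \<le> (\<integral>\<^sup>+z. ennreal \<bar>x$i - z$i\<bar> * indicator {z. same x z} z \<partial>\<kappa>)"
proof -
  \<comment> \<open>With this length the slab around \<open>x\<close> has
    \<open>\<kappa>\<close>-mass at most \<open>\<beta> * (2 * l * v) = q x / 2\<close>.\<close>
  define l where "l = q x / (4 * \<beta> * v)"
  have l: "l \<ge> 0"
    using \<beta> v_pos q_nonneg[of x] by (simp add: l_def)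
  define E where "E = {z. same x z \<and> \<bar>x$i - z$i\<bar> \<le> l}"
  have E [measurable]: "E \<in> sets borel"
    unfolding E_def by measurable
  have "ennreal (measure \<kappa> E) \<le> ennreal \<beta> * ennreal (2 * l * v)"
    using \<beta>(2)[OF E] slab_volume[OF l, of x]
    by (metis E_def \<kappa>.emeasure_eq_measure mult_left_mono order_trans zero_le)
  also have "\<dots> = ennreal (q x / 2)"
  proof -
    have "\<beta> * (2 * l * v) = q x / 2"
      using \<beta>(1) v_pos by (simp add: l_def)
    moreover have "ennreal \<beta> * ennreal (2 * l * v) = ennreal (\<beta> * (2 * l * v))"
      using \<beta>(1) v_pos l by (intro ennreal_mult[symmetric]) auto
    ultimately show ?thesis
      by metis
  qed
  finally have "measure \<kappa> E \<le> q x / 2"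
    using q_nonneg[of x] by (simp add: ennreal_le_iff)
  moreover have "measure \<kappa> ({z. same x z} - E) = q x - measure \<kappa> E"
    unfolding q_def by (rule \<kappa>.finite_measure_Diff) (auto simp: E_def)
  ultimately have "q x / 2 \<le> measure \<kappa> ({z. same x z} - E)"
    by simp
  then have "l * (q x / 2) \<le> l * measure \<kappa> ({z. same x z} - E)"
    using l by (rule mult_left_mono)
  moreover have "(q x)\<^sup>2 / (8 * \<beta> * v) = l * (q x / 2)"
    by (simp add: l_def power2_eq_square)
  ultimately have "ennreal ((q x)\<^sup>2 / (8 * \<beta> * v)) \<le> ennreal l * emeasure \<kappa> ({z. same x z} - E)"
    using l by (simp add: \<kappa>.emeasure_eq_measure flip: ennreal_mult)
  also have "\<dots> = (\<integral>\<^sup>+z. ennreal l * indicator ({z. same x z} - E) z \<partial>\<kappa>)"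
    by (simp add: nn_integral_cmult_indicator)
  also have "\<dots> \<le> (\<integral>\<^sup>+z. ennreal \<bar>x$i - z$i\<bar> * indicator {z. same x z} z \<partial>\<kappa>)"
    by (intro nn_integral_mono) (auto simp: indicator_def E_def intro!: ennreal_leI)
  finally show ?thesis .
qed

text \<open>Cauchy-Schwarz over the cells that meet the cube of half side \<open>B\<close>. The
  product bounds their number, and the integral of \<open>q\<close> dominates the sum of the squared
  cell masses.\<close>

lemma mass_square_le:
  assumes B: "AE x in \<kappa>. \<forall>j. \<bar>x$j\<bar> \<le> B" "B \<ge> 0"
  shows "ennreal ((measure \<kappa> UNIV)\<^sup>2) \<le> ennreal (\<Prod>j\<in>UNIV. 2 * B / a j + 2) * (\<integral>\<^sup>+x. q x \<partial>\<kappa>)"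
proof -
  define cell where "cell x = (\<lambda>j. \<lfloor>x$j / a j\<rfloor>)" for x :: "real^'n"
  define Q where "Q = PiE UNIV (\<lambda>j. {\<lfloor>- B / a j\<rfloor>..\<lfloor>B / a j\<rfloor>})"
  define m where "m k = measure \<kappa> {x. cell x = k}" for k
  have cell_meas [measurable]: "{x. cell x = k} \<in> sets borel" for k
  proof -
    have "Measurable.pred borel (\<lambda>x. cell x = k)"
      unfolding cell_def fun_eq_iff by measurable
    then show ?thesis
      by simp
  qed
  have fin: "finite Q"
    unfolding Q_def by (intro finite_PiE) auto
  have card_le: "real (card Q) \<le> (\<Prod>j\<in>UNIV. 2 * B / a j + 2)"
  proof -
    have "real (card Q) = (\<Prod>j\<in>UNIV. real (card {\<lfloor>- B / a j\<rfloor>..\<lfloor>B / a j\<rfloor>}))"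
      unfolding Q_def by (simp add: card_PiE)
    also have "\<dots> \<le> (\<Prod>j\<in>UNIV. 2 * B / a j + 2)"
    proof (rule prod_mono, intro conjI)
      fix j
      have "B / a j \<ge> 0" "- B / a j = - (B / a j)"
        using B(2) a_pos[of j] by auto
      \<comment> \<open>With \<open>u = B / a j\<close> the number of integers is
        \<open>\<lfloor>u\<rfloor> - \<lfloor>- u\<rfloor> + 1\<close>, which is below
        \<open>2 * u + 2\<close>.\<close>
      then show "real (card {\<lfloor>- B / a j\<rfloor>..\<lfloor>B / a j\<rfloor>}) \<le> 2 * B / a j + 2"
        unfolding card_atLeastAtMost_int times_divide_eq_right[symmetric] by linarith
    qed simp
    finally show ?thesis .
  qed
  have inQ: "cell x \<in> Q" if "\<forall>j. \<bar>x$j\<bar> \<le> B" for x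
  proof -
    have "- B / a j \<le> x$j / a j" "x$j / a j \<le> B / a j" for j
    proof -
      have "- B \<le> x$j" "x$j \<le> B" "0 \<le> a j"
        using that[rule_format, of j] a_pos[of j] by auto
      then show "- B / a j \<le> x$j / a j" "x$j / a j \<le> B / a j"
        by (auto intro: divide_right_mono simp del: divide_minus_left)
    qed
    then show ?thesis
      unfolding Q_def cell_def by (auto intro!: floor_mono)
  qed
  have "measure \<kappa> UNIV = measure \<kappa> (\<Union>k\<in>Q. {x. cell x = k})"
    using B(1) fin by (intro \<kappa>.finite_measure_eq_AE) (auto dest: inQ)
  also have "\<dots> = (\<Sum>k\<in>Q. m k)"
    unfolding m_def
    by (rule \<kappa>.finite_measure_finite_Union[OF fin]) (auto simp: disjoint_family_on_def)
  finally have total: "measure \<kappa> UNIV = (\<Sum>k\<in>Q. m k)" .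
  have "ennreal (\<Sum>k\<in>Q. (m k)\<^sup>2) = (\<Sum>k\<in>Q. ennreal (m k) * emeasure \<kappa> {x. cell x = k})"
    by (simp add: m_def \<kappa>.emeasure_eq_measure power2_eq_square sum_ennreal flip: ennreal_mult)
  also have "\<dots> = (\<Sum>k\<in>Q. \<integral>\<^sup>+x. ennreal (m k) * indicator {x. cell x = k} x \<partial>\<kappa>)"
    by (simp add: nn_integral_cmult_indicator)
  also have "\<dots> = (\<integral>\<^sup>+x. (\<Sum>k\<in>Q. ennreal (m k) * indicator {x. cell x = k} x) \<partial>\<kappa>)"
    by (rule nn_integral_sum[symmetric]) measurable
  also have "\<dots> \<le> (\<integral>\<^sup>+x. q x \<partial>\<kappa>)"
  proof (rule nn_integral_mono)
    fix x
    \<comment> \<open>Only the cell of \<open>x\<close> contributes, and there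
      \<open>m k = q x\<close>; the sum is empty of contributions if that cell is outside
      \<open>Q\<close>.\<close>
    have "(\<Sum>k\<in>Q. ennreal (m k) * indicator {x. cell x = k} x) = (\<Sum>k\<in>Q. if k = cell x then ennreal (q x) else 0)"
      by (intro sum.cong) (auto simp: indicator_def m_def q_def same_def cell_def fun_eq_iff intro!: arg_cong[where f="measure \<kappa>"])
    also have "\<dots> \<le> ennreal (q x)"
      using fin by (simp add: sum.delta)
    finally show "(\<Sum>k\<in>Q. ennreal (m k) * indicator {x. cell x = k} x) \<le> ennreal (q x)" .
  qed
  finally have sq: "ennreal (\<Sum>k\<in>Q. (m k)\<^sup>2) \<le> (\<integral>\<^sup>+x. q x \<partial>\<kappa>)" .
  have "(measure \<kappa> UNIV)\<^sup>2 \<le> real (card Q) * (\<Sum>k\<in>Q. (m k)\<^sup>2)"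
    unfolding total by (subst mult.commute) (rule sum_squared_le_sum_of_squares)
  also have "\<dots> \<le> (\<Prod>j\<in>UNIV. 2 * B / a j + 2) * (\<Sum>k\<in>Q. (m k)\<^sup>2)"
    by (intro mult_right_mono card_le sum_nonneg) auto
  finally have "ennreal ((measure \<kappa> UNIV)\<^sup>2) \<le> ennreal ((\<Prod>j\<in>UNIV. 2 * B / a j + 2) * (\<Sum>k\<in>Q. (m k)\<^sup>2))"
    by (rule ennreal_leI)
  also have "\<dots> = ennreal (\<Prod>j\<in>UNIV. 2 * B / a j + 2) * ennreal (\<Sum>k\<in>Q. (m k)\<^sup>2)"
    using card_le by (intro ennreal_mult sum_nonneg) (auto intro: order_trans[OF of_nat_0_le_iff])
  also have "\<dots> \<le> ennreal (\<Prod>j\<in>UNIV. 2 * B / a j + 2) * (\<integral>\<^sup>+x. q x \<partial>\<kappa>)"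
    by (intro mult_left_mono sq) simp
  finally show ?thesis .
qed

text \<open>Of two points of a cell at different heights exactly one is ahead of the other, so the
  forward displacement plus its transpose is the full distance in direction \<open>i\<close>,
  weighted by \<open>1 / q\<close>. Fubini makes both halves equal, which doubles the 8 of
  \<open>spread_lower_bound\<close> to 16.\<close>

lemma gain_lower_bound:
  assumes \<beta>: "\<beta> > 0" "\<And>A. A \<in> sets borel \<Longrightarrow> emeasure \<kappa> A \<le> ennreal \<beta> * emeasure lborel A"
  shows "(\<integral>\<^sup>+x. q x \<partial>\<kappa>) \<le> ennreal (16 * \<beta> * v) *
    (\<integral>\<^sup>+p. (\<integral>\<^sup>+z. ennreal (r (fst p) z) * ennreal (s * (z$i - fst p$i)) \<partial>\<kappa>) \<partial>\<theta>)"
proof -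
  interpret \<kappa>\<kappa>: pair_sigma_finite \<kappa> \<kappa>
    unfolding pair_sigma_finite_def by (intro conjI) unfold_locales
  define h where "h x z = ennreal (r x z) * ennreal (s * (z$i - x$i))" for x z
  have h_meas [measurable]: "(\<lambda>p. h (fst p) (snd p)) \<in> borel_measurable (borel \<Otimes>\<^sub>M borel)"
    unfolding h_def by measurable
  have h_meas' [measurable]: "(\<lambda>z. h x z) \<in> borel_measurable borel" "(\<lambda>z. h z x) \<in> borel_measurable borel" for x
    unfolding h_def by measurable
  define I where "I = (\<integral>\<^sup>+x. (\<integral>\<^sup>+z. h x z \<partial>\<kappa>) \<partial>\<kappa>)"
  have I_swap: "I = (\<integral>\<^sup>+x. (\<integral>\<^sup>+z. h z x \<partial>\<kappa>) \<partial>\<kappa>)"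
    unfolding I_def by (rule \<kappa>\<kappa>.Fubini'[symmetric]) (simp add: case_prod_beta' cong: measurable_cong_sets)
  have eq: "h x z + h z x = ennreal (1 / q x) * (ennreal \<bar>x$i - z$i\<bar> * indicator {z. same x z} z)" for x z
  proof (cases "same x z")
    case True
    consider "s * x$i < s * z$i" | "s * z$i < s * x$i" | "x$i = z$i"
      using s_cases by fastforce
    then show ?thesis
    proof cases
      case 1
      then have "s * (z$i - x$i) = \<bar>x$i - z$i\<bar>"
        using s_cases by auto
      then show ?thesis
        using True 1 by (simp add: h_def r_def)
    next
      case 2
      then have "s * (x$i - z$i) = \<bar>x$i - z$i\<bar>"
        using s_cases by auto
      then show ?thesis
        using True 2 q_cong[OF True] by (simp add: h_def r_def same_sym[of z])
    next
      case 3
      then show ?thesis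
        by (simp add: h_def r_def)
    qed
  next
    case False
    then show ?thesis
      by (simp add: h_def r_def same_sym[of z])
  qed
  have "(\<integral>\<^sup>+x. q x \<partial>\<kappa>) \<le> (\<integral>\<^sup>+x. ennreal (8 * \<beta> * v) * (\<integral>\<^sup>+z. h x z + h z x \<partial>\<kappa>) \<partial>\<kappa>)"
  proof (rule nn_integral_mono)
    fix x
    \<comment> \<open>The weight \<open>1 / q x\<close> turns the quadratic spread bound into a
      linear one; for \<open>q x = 0\<close> both sides vanish.\<close>
    have "ennreal (q x) \<le> ennreal (8 * \<beta> * v) * (ennreal (1 / q x) * ennreal ((q x)\<^sup>2 / (8 * \<beta> * v)))"
      using \<beta>(1) v_pos q_nonneg[of x]
      by (cases "q x = 0") (simp_all add: power2_eq_square flip: ennreal_mult)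
    also have "\<dots> \<le> ennreal (8 * \<beta> * v) * (ennreal (1 / q x) *
        (\<integral>\<^sup>+z. ennreal \<bar>x$i - z$i\<bar> * indicator {z. same x z} z \<partial>\<kappa>))"
      by (intro mult_left_mono spread_lower_bound \<beta>) auto
    also have "\<dots> = ennreal (8 * \<beta> * v) * (\<integral>\<^sup>+z. h x z + h z x \<partial>\<kappa>)"
      unfolding eq by (subst nn_integral_cmult) auto
    finally show "ennreal (q x) \<le> ennreal (8 * \<beta> * v) * (\<integral>\<^sup>+z. h x z + h z x \<partial>\<kappa>)" .
  qed
  also have "\<dots> = ennreal (8 * \<beta> * v) * (\<integral>\<^sup>+x. (\<integral>\<^sup>+z. h x z \<partial>\<kappa>) + (\<integral>\<^sup>+z. h z x \<partial>\<kappa>) \<partial>\<kappa>)"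
  proof -
    have 1: "(\<lambda>x. \<integral>\<^sup>+z. h x z \<partial>\<kappa>) \<in> borel_measurable \<kappa>" "(\<lambda>x. \<integral>\<^sup>+z. h z x \<partial>\<kappa>) \<in> borel_measurable \<kappa>"
      unfolding h_def by measurable
    show ?thesis
      using 1 by (simp add: nn_integral_add nn_integral_cmult)
  qed
  also have "\<dots> = ennreal (8 * \<beta> * v) * (I + I)"
  proof -
    have 1: "(\<lambda>x. \<integral>\<^sup>+z. h x z \<partial>\<kappa>) \<in> borel_measurable \<kappa>" "(\<lambda>x. \<integral>\<^sup>+z. h z x \<partial>\<kappa>) \<in> borel_measurable \<kappa>"
      unfolding h_def by measurable
    show ?thesis
      using 1 by (subst nn_integral_add) (simp_all add: I_def[symmetric] I_swap[symmetric])
  qed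
  also have "\<dots> = ennreal (16 * \<beta> * v) * I"
  proof -
    have "ennreal (16 * \<beta> * v) = ennreal (8 * \<beta> * v) + ennreal (8 * \<beta> * v)"
      using \<beta>(1) v_pos by (simp flip: ennreal_plus)
    then show ?thesis
      by (simp add: distrib_left distrib_right)
  qed
  also have "I = (\<integral>\<^sup>+p. (\<integral>\<^sup>+z. h (fst p) z \<partial>\<kappa>) \<partial>\<theta>)"
    unfolding I_def by (rule nn_integral_\<theta>_fst[symmetric]) (unfold h_def, measurable)
  finally show ?thesis
    unfolding h_def .
qed

end

section \<open>Change of the quadratic cost under the exchange\<close>

lemma cost_cart: "cost x y = 1/2 * (\<Sum>j\<in>UNIV. (x$j - y$j)\<^sup>2)" for x y :: "real^'n"
  unfolding cost_def power2_norm_eq_inner inner_vec_def by (simp add: power2_eq_square)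

lemma cost_nonneg: "cost x y \<ge> 0"
  by (simp add: cost_def)

lemma cost_measurable: "(\<lambda>p. cost (fst p) (snd p)) \<in> borel_measurable (borel :: ('a::euclidean_space \<times> 'a) measure)"
  unfolding cost_def by (intro borel_measurable_continuous_onI continuous_intros)

context tube_exchange
begin

lemma cost_meas [measurable]:
  "(\<lambda>p. cost (fst p) (snd p)) \<in> borel_measurable ((borel :: (real^'n) measure) \<Otimes>\<^sub>M borel)"
  unfolding borel_prod by (rule cost_measurable)

lemma cost_meas' [measurable (raw)]:
  fixes f g :: "'b \<Rightarrow> real^'n"
  assumes [measurable]: "f \<in> measurable M borel" "g \<in> measurable M borel"
  shows "(\<lambda>p. cost (f p) (g p)) \<in> borel_measurable M"
  using measurable_compose[OF _ cost_meas, of "\<lambda>p. (f p, g p)" M] by simp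

text \<open>In direction \<open>i\<close> the starting point moves by at most \<open>d\<close>
  towards an endpoint at least \<open>d\<close> ahead, so it does not overshoot and the squared
  distance drops by at least \<open>d\<close> times the step. Each other coordinate moves by at most
  \<open>\<tau>\<close>, which raises its square by at most \<open>4 * B * \<tau>\<close>. The cost
  is half of the sum.\<close>

lemma exchange_pointwise:
  assumes "same x z" "s * x$i < s * z$i" "d \<le> s * (y$i - x$i)"
    and a: "a i \<le> d" "\<And>j. j \<noteq> i \<Longrightarrow> a j \<le> \<tau>" and "\<tau> \<ge> 0"
    and B: "\<forall>j. \<bar>x$j\<bar> \<le> B" "\<forall>j. \<bar>y$j\<bar> \<le> B" "\<forall>j. \<bar>z$j\<bar> \<le> B"
  shows "cost z y + d / 2 * (s * (z$i - x$i)) \<le> cost x y + 2 * real CARD('n) * B * \<tau>"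
proof -
  define t where "t = s * (z$i - x$i)"
  have "B \<ge> 0"
    using B(1) abs_ge_zero order_trans by blast
  have t: "0 < t" "t \<le> d"
  proof -
    show "0 < t"
      using assms(2) by (simp add: t_def algebra_simps)
    have "t \<le> \<bar>x$i - z$i\<bar>"
      using s_cases by (auto simp: t_def)
    then show "t \<le> d"
      using same_nth[OF assms(1), of i] a(1) by linarith
  qed
  have ti: "(z$i - y$i)\<^sup>2 + d * t \<le> (x$i - y$i)\<^sup>2"
  proof -
    define D where "D = s * (y$i - x$i)"
    have s2: "s * s = 1"
      using s_cases by auto
    have "z$i - y$i = s * (t - D)" "x$i - y$i = - s * D"
      using s2 by (auto simp: t_def D_def algebra_simps mult.assoc[symmetric])
    then have "(z$i - y$i)\<^sup>2 = (t - D)\<^sup>2" "(x$i - y$i)\<^sup>2 = D\<^sup>2"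
      using s2 by (simp_all add: power_mult_distrib power2_eq_square)
    \<comment> \<open>The sum of the two says \<open>t\<^sup>2 + d * t \<le> 2 * t * D\<close>, the
      claim after expanding \<open>(t - D)\<^sup>2\<close>.\<close>
    moreover have "t * (D - t) \<ge> 0" "t * (D - d) \<ge> 0"
      using t assms(3) by (auto simp: D_def)
    ultimately show ?thesis
      by (simp add: power2_eq_square algebra_simps)
  qed
  have tj: "(z$j - y$j)\<^sup>2 \<le> (x$j - y$j)\<^sup>2 + 4 * B * \<tau>" if "j \<noteq> i" for j
  proof -
    have "(z$j - y$j)\<^sup>2 - (x$j - y$j)\<^sup>2 = (z$j - x$j) * (z$j + x$j - 2 * y$j)"
      by (simp add: power2_eq_square algebra_simps)
    also have "\<dots> \<le> \<bar>z$j - x$j\<bar> * \<bar>z$j + x$j - 2 * y$j\<bar>"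
      by (simp add: abs_mult[symmetric])
    also have "\<dots> \<le> \<tau> * (4 * B)"
    proof (rule mult_mono)
      show "\<bar>z$j - x$j\<bar> \<le> \<tau>"
        using same_nth[OF assms(1), of j] a(2)[OF that] by linarith
      show "\<bar>z$j + x$j - 2 * y$j\<bar> \<le> 4 * B"
        using B(1)[rule_format, of j] B(2)[rule_format, of j] B(3)[rule_format, of j] by linarith
    qed (use \<open>\<tau> \<ge> 0\<close> in auto)
    finally show ?thesis
      by (simp add: algebra_simps)
  qed
  have "(\<Sum>j\<in>UNIV. (z$j - y$j)\<^sup>2) + d * t = (\<Sum>j\<in>UNIV. (z$j - y$j)\<^sup>2 + (if j = i then d * t else 0))"
    by (simp add: sum.distrib)
  also have "\<dots> \<le> (\<Sum>j\<in>UNIV. (x$j - y$j)\<^sup>2 + 4 * B * \<tau>)"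
  proof (rule sum_mono)
    fix j
    have "0 \<le> 4 * B * \<tau>"
      using \<open>B \<ge> 0\<close> \<open>\<tau> \<ge> 0\<close> by simp
    then show "(z$j - y$j)\<^sup>2 + (if j = i then d * t else 0) \<le> (x$j - y$j)\<^sup>2 + 4 * B * \<tau>"
      using ti tj[of j] by (cases "j = i") auto
  qed
  also have "\<dots> = (\<Sum>j\<in>UNIV. (x$j - y$j)\<^sup>2) + real CARD('n) * (4 * B * \<tau>)"
    by (simp add: sum.distrib)
  finally show ?thesis
    unfolding cost_cart t_def by (simp add: algebra_simps)
qed

lemma measure_\<kappa>_UNIV: "measure \<kappa> UNIV = measure \<theta> UNIV"
  unfolding \<kappa>_def by (subst measure_distr) auto

text \<open>Integrating \<open>exchange_pointwise\<close> gains \<open>d / 2\<close> times the total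
  forward displacement \<open>I\<close>, and \<open>mass_square_le\<close> with
  \<open>gain_lower_bound\<close> bounds \<open>I\<close> below by the squared mass over
  \<open>16 * \<beta> * v * N\<close>. All terms are kept additive because subtraction of extended
  reals truncates.\<close>

lemma exchange_cost:
  assumes \<beta>: "\<beta> > 0" "\<And>A. A \<in> sets borel \<Longrightarrow> emeasure \<kappa> A \<le> ennreal \<beta> * emeasure lborel A"
    and a: "a i \<le> d" "\<And>j. j \<noteq> i \<Longrightarrow> a j \<le> \<tau>" and "\<tau> \<ge> 0" "B \<ge> 0" "d > 0"
    and conc: "AE p in \<theta>. (\<forall>j. \<bar>fst p$j\<bar> \<le> B) \<and> (\<forall>j. \<bar>snd p$j\<bar> \<le> B) \<and> d \<le> s * (snd p$i - fst p$i)"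
  shows "(\<integral>\<^sup>+p. cost (fst p) (snd p) \<partial>\<xi>)
      + ennreal (d / (32 * \<beta> * (v * (\<Prod>j\<in>UNIV. 2 * B / a j + 2))) * (measure \<theta> UNIV)\<^sup>2)
    \<le> (\<integral>\<^sup>+p. ennreal (\<rho> (fst p)) * ennreal (cost (fst p) (snd p)) \<partial>\<theta>)
      + ennreal (2 * real CARD('n) * B * \<tau> * measure \<theta> UNIV)"
proof -
  define N where "N = (\<Prod>j\<in>UNIV. 2 * B / a j + 2)"
  have N: "N > 0"
    unfolding N_def using a_pos \<open>B \<ge> 0\<close> by (intro prod_pos) (simp add: add_nonneg_pos less_imp_le)
  define I where "I = (\<integral>\<^sup>+p. (\<integral>\<^sup>+z. ennreal (r (fst p) z) * ennreal (s * (z$i - fst p$i)) \<partial>\<kappa>) \<partial>\<theta>)"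
  define T where "T = 2 * real CARD('n) * B * \<tau>"
  have T: "T \<ge> 0"
    using \<open>\<tau> \<ge> 0\<close> \<open>B \<ge> 0\<close> by (simp add: T_def)
  have pred [measurable]: "Measurable.pred borel (\<lambda>x::real^'n. \<forall>j. \<bar>x$j\<bar> \<le> B)"
    by measurable
  have \<kappa>B: "AE x in \<kappa>. \<forall>j. \<bar>x$j\<bar> \<le> B"
    unfolding \<kappa>_def using conc by (subst AE_distr_iff) (auto elim: eventually_mono)
  have "ennreal (d / (32 * \<beta> * (v * N)) * (measure \<theta> UNIV)\<^sup>2)
      = ennreal (d / (32 * \<beta> * (v * N))) * ennreal ((measure \<kappa> UNIV)\<^sup>2)"
    unfolding measure_\<kappa>_UNIV using \<open>d > 0\<close> \<beta>(1) v_pos N by (intro ennreal_mult) auto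
  also have "\<dots> \<le> ennreal (d / (32 * \<beta> * (v * N))) * (ennreal N * (ennreal (16 * \<beta> * v) * I))"
  proof (rule mult_left_mono)
    have "ennreal ((measure \<kappa> UNIV)\<^sup>2) \<le> ennreal N * (\<integral>\<^sup>+x. q x \<partial>\<kappa>)"
      unfolding N_def by (rule mass_square_le[OF \<kappa>B \<open>B \<ge> 0\<close>])
    also have "\<dots> \<le> ennreal N * (ennreal (16 * \<beta> * v) * I)"
      unfolding I_def by (intro mult_left_mono gain_lower_bound \<beta>) auto
    finally show "ennreal ((measure \<kappa> UNIV)\<^sup>2) \<le> ennreal N * (ennreal (16 * \<beta> * v) * I)" .
  qed simp
  also have "\<dots> = ennreal (d / (32 * \<beta> * (v * N)) * (N * (16 * \<beta> * v))) * I"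
  proof -
    have "ennreal (d / (32 * \<beta> * (v * N)) * (N * (16 * \<beta> * v)))
        = ennreal (d / (32 * \<beta> * (v * N))) * (ennreal N * ennreal (16 * \<beta> * v))"
      using \<open>d > 0\<close> \<beta>(1) v_pos N
        ennreal_mult[of N "16 * \<beta> * v"] ennreal_mult[of "d / (32 * \<beta> * (v * N))" "N * (16 * \<beta> * v)"]
      by auto
    then show ?thesis
      by (simp only: mult.assoc)
  qed
  also have "d / (32 * \<beta> * (v * N)) * (N * (16 * \<beta> * v)) = d / 2"
    using \<beta>(1) v_pos N by (simp add: field_simps)
  finally have lower: "ennreal (d / (32 * \<beta> * (v * N)) * (measure \<theta> UNIV)\<^sup>2) \<le> ennreal (d / 2) * I" .
  have "(\<integral>\<^sup>+p. cost (fst p) (snd p) \<partial>\<xi>) + ennreal (d / 2) * I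
    = (\<integral>\<^sup>+p. (\<integral>\<^sup>+z. ennreal (r (fst p) z) * ennreal (cost z (snd p)) \<partial>\<kappa>) \<partial>\<theta>)
      + (\<integral>\<^sup>+p. ennreal (d / 2) * (\<integral>\<^sup>+z. ennreal (r (fst p) z) * ennreal (s * (z$i - fst p$i)) \<partial>\<kappa>) \<partial>\<theta>)"
    unfolding I_def by (simp add: nn_integral_\<xi> nn_integral_cmult)
  also have "\<dots> = (\<integral>\<^sup>+p. (\<integral>\<^sup>+z. ennreal (r (fst p) z) * ennreal (cost z (snd p))
        + ennreal (d / 2) * (ennreal (r (fst p) z) * ennreal (s * (z$i - fst p$i))) \<partial>\<kappa>) \<partial>\<theta>)"
    by (simp add: nn_integral_add nn_integral_cmult)
  also have "\<dots> \<le> (\<integral>\<^sup>+p. (\<integral>\<^sup>+z. ennreal (r (fst p) z) * ennreal (cost (fst p) (snd p) + T) \<partial>\<kappa>) \<partial>\<theta>)"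
  proof (rule nn_integral_mono_AE, rule AE_mp[OF conc], rule AE_I2, rule impI)
    fix p :: "(real^'n) \<times> (real^'n)"
    assume p: "(\<forall>j. \<bar>fst p$j\<bar> \<le> B) \<and> (\<forall>j. \<bar>snd p$j\<bar> \<le> B) \<and> d \<le> s * (snd p$i - fst p$i)"
    show "(\<integral>\<^sup>+z. ennreal (r (fst p) z) * ennreal (cost z (snd p))
        + ennreal (d / 2) * (ennreal (r (fst p) z) * ennreal (s * (z$i - fst p$i))) \<partial>\<kappa>)
      \<le> (\<integral>\<^sup>+z. ennreal (r (fst p) z) * ennreal (cost (fst p) (snd p) + T) \<partial>\<kappa>)"
    proof (rule nn_integral_mono_AE, rule AE_mp[OF \<kappa>B], rule AE_I2, rule impI)
      fix z :: "real^'n"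
      assume z: "\<forall>j. \<bar>z$j\<bar> \<le> B"
      show "ennreal (r (fst p) z) * ennreal (cost z (snd p))
          + ennreal (d / 2) * (ennreal (r (fst p) z) * ennreal (s * (z$i - fst p$i)))
        \<le> ennreal (r (fst p) z) * ennreal (cost (fst p) (snd p) + T)"
      proof (cases "same (fst p) z \<and> s * fst p$i < s * z$i")
        case True
        then have pos: "0 \<le> s * (z$i - fst p$i)"
          by (simp add: algebra_simps)
        have "ennreal (r (fst p) z) * ennreal (cost z (snd p))
            + ennreal (d / 2) * (ennreal (r (fst p) z) * ennreal (s * (z$i - fst p$i)))
          = ennreal (r (fst p) z) * ennreal (cost z (snd p) + d / 2 * (s * (z$i - fst p$i)))"
        proof -
          have "ennreal (cost z (snd p) + d / 2 * (s * (z$i - fst p$i)))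
              = ennreal (cost z (snd p)) + ennreal (d / 2 * (s * (z$i - fst p$i)))"
            using mult_nonneg_nonneg[OF _ pos, of "d / 2"] \<open>d > 0\<close> by (intro ennreal_plus cost_nonneg) auto
          also have "ennreal (d / 2 * (s * (z$i - fst p$i))) = ennreal (d / 2) * ennreal (s * (z$i - fst p$i))"
            using pos \<open>d > 0\<close> by (intro ennreal_mult) auto
          finally show ?thesis
            by (simp only: distrib_left mult.left_commute)
        qed
        also have "\<dots> \<le> ennreal (r (fst p) z) * ennreal (cost (fst p) (snd p) + T)"
          unfolding T_def using True p z a \<open>\<tau> \<ge> 0\<close>
          by (intro mult_left_mono ennreal_leI exchange_pointwise) auto
        finally show ?thesis .
      next
        case False
        then have "r (fst p) z = 0"
          by (auto simp: r_def)
        then show ?thesis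
          by simp
      qed
    qed
  qed
  also have "\<dots> = (\<integral>\<^sup>+p. ennreal (\<rho> (fst p)) * ennreal (cost (fst p) (snd p) + T) \<partial>\<theta>)"
    by (simp add: nn_integral_multc nn_integral_r)
  \<comment> \<open>Since \<open>\<rho> \<le> 1\<close>, the sideways loss \<open>T\<close> may be
    charged to all of \<open>\<theta>\<close>.\<close>
  also have "\<dots> \<le> (\<integral>\<^sup>+p. ennreal (\<rho> (fst p)) * ennreal (cost (fst p) (snd p)) + ennreal T \<partial>\<theta>)"
  proof (rule nn_integral_mono)
    fix p :: "(real^'n) \<times> (real^'n)"
    have "\<rho> (fst p) * T \<le> 1 * T"
      by (intro mult_right_mono \<rho>_le_1 T)
    then show "ennreal (\<rho> (fst p)) * ennreal (cost (fst p) (snd p) + T)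
      \<le> ennreal (\<rho> (fst p)) * ennreal (cost (fst p) (snd p)) + ennreal T"
      using T by (simp add: distrib_left cost_nonneg \<rho>_nonneg flip: ennreal_mult ennreal_plus)
  qed
  also have "\<dots> = (\<integral>\<^sup>+p. ennreal (\<rho> (fst p)) * ennreal (cost (fst p) (snd p)) \<partial>\<theta>) + ennreal (T * measure \<theta> UNIV)"
    using T by (simp add: nn_integral_add \<theta>.emeasure_eq_measure ennreal_mult)
  finally show ?thesis
    unfolding N_def[symmetric] T_def[symmetric] by (rule order_trans[OF add_left_mono[OF lower]])
qed

end

text \<open>The gain constant of \<open>exchange_cost\<close> for tube pieces of length
  \<open>d\<close>, with cross section times number of cells replaced by a bound valid for all
  widths up to 1.\<close>

definition convexity_const :: "nat \<Rightarrow> real \<Rightarrow> real \<Rightarrow> real \<Rightarrow> real" where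
  "convexity_const n d B \<beta> = d / (32 * \<beta> * ((2 * B + 2) ^ (n - 1) * (2 * B / d + 2)))"

text \<open>The tubes are made so thin that the sideways loss is below \<open>\<epsilon>\<close>.
  The gain survives because the cross section of a tube and the number of tubes compensate each
  other.\<close>

lemma exchange_exists:
  fixes \<theta> :: "((real^'n) \<times> (real^'n)) measure" and i :: 'n
  assumes "finite_measure \<theta>" "sets \<theta> = sets borel" "s = 1 \<or> s = -1"
    and \<beta>: "\<beta> > 0" "\<And>A. A \<in> sets borel \<Longrightarrow> emeasure \<theta> (A \<times> UNIV) \<le> ennreal \<beta> * emeasure lborel A"
    and "B \<ge> 0" "d > 0" "\<epsilon> > 0"
    and conc: "AE p in \<theta>. (\<forall>j. \<bar>fst p$j\<bar> \<le> B) \<and> (\<forall>j. \<bar>snd p$j\<bar> \<le> B) \<and> d \<le> s * (snd p$i - fst p$i)"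
  obtains \<rho> \<xi> where "\<rho> \<in> borel_measurable borel" "\<And>x. 0 \<le> \<rho> x" "\<And>x. \<rho> x \<le> 1"
    "sets \<xi> = sets borel"
    "\<And>A. A \<in> sets borel \<Longrightarrow> emeasure \<xi> (A \<times> UNIV) \<le> emeasure \<theta> (A \<times> UNIV)"
    "\<And>A. A \<in> sets borel \<Longrightarrow>
      emeasure \<xi> (UNIV \<times> A) = (\<integral>\<^sup>+p. ennreal (\<rho> (fst p)) * indicator (UNIV \<times> A) p \<partial>\<theta>)"
    "(\<integral>\<^sup>+p. cost (fst p) (snd p) \<partial>\<xi>) + ennreal (convexity_const CARD('n) d B \<beta> * (measure \<theta> UNIV)\<^sup>2)
      \<le> (\<integral>\<^sup>+p. ennreal (\<rho> (fst p)) * ennreal (cost (fst p) (snd p)) \<partial>\<theta>) + ennreal \<epsilon>"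
proof -
  define E where "E = 2 * real CARD('n) * B * measure \<theta> UNIV"
  have E: "E \<ge> 0"
    using \<open>B \<ge> 0\<close> by (simp add: E_def)
  \<comment> \<open>\<open>E + 1\<close> instead of \<open>E\<close> keeps the denominator positive;
    the cap 1 makes the bound on \<open>v\<close> times the number of cells uniform.\<close>
  define \<tau> where "\<tau> = min 1 (\<epsilon> / (E + 1))"
  have \<tau>: "0 < \<tau>" "\<tau> \<le> 1"
    using E \<open>\<epsilon> > 0\<close> by (auto simp: \<tau>_def)
  have E\<tau>: "E * \<tau> \<le> \<epsilon>"
  proof -
    have "E * \<tau> \<le> (E + 1) * (\<epsilon> / (E + 1))"
      using E \<tau> \<open>\<epsilon> > 0\<close> by (intro mult_mono) (auto simp: \<tau>_def)
    then show ?thesis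
      using E by simp
  qed
  define a where "a j = (if j = i then d else \<tau>)" for j
  interpret tube_exchange \<theta> i s a
    by (rule tube_exchange.intro) (use assms(1-3) \<tau> \<open>d > 0\<close> in \<open>simp_all add: a_def\<close>)
  have \<kappa>: "emeasure \<kappa> A = emeasure \<theta> (A \<times> UNIV)" if A: "A \<in> sets borel" for A
  proof -
    have "fst -` A \<inter> space \<theta> = A \<times> UNIV"
      by auto
    then show ?thesis
      unfolding \<kappa>_def using A by (subst emeasure_distr) auto
  qed
  \<comment> \<open>Each transversal coordinate contributes
    \<open>\<tau> * (2 * B / \<tau> + 2) = 2 * B + 2 * \<tau>\<close>, which is at most
    \<open>2 * B + 2\<close>; in direction \<open>i\<close> only the count enters.\<close>
  have vN: "v * (\<Prod>j\<in>UNIV. 2 * B / a j + 2) \<le> (2 * B + 2) ^ (CARD('n) - 1) * (2 * B / d + 2)"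
  proof -
    have "(\<Prod>j\<in>UNIV. 2 * B / a j + 2) = (2 * B / d + 2) * (\<Prod>j\<in>UNIV - {i}. 2 * B / a j + 2)"
      by (subst prod.remove[of _ i]) (auto simp: a_def)
    also have "(\<Prod>j\<in>UNIV - {i}. 2 * B / a j + 2) = (2 * B / \<tau> + 2) ^ (CARD('n) - 1)"
      by (simp add: a_def)
    finally have "v * (\<Prod>j\<in>UNIV. 2 * B / a j + 2)
        = (\<tau> * (2 * B / \<tau> + 2)) ^ (CARD('n) - 1) * (2 * B / d + 2)"
      by (simp add: v_def a_def power_mult_distrib)
    also have "\<dots> \<le> (2 * B + 2) ^ (CARD('n) - 1) * (2 * B / d + 2)"
      using \<tau> \<open>B \<ge> 0\<close> \<open>d > 0\<close> by (intro mult_right_mono power_mono) (auto simp: algebra_simps)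
    finally show ?thesis .
  qed
  have vN_pos: "v * (\<Prod>j\<in>UNIV. 2 * B / a j + 2) > 0"
    using v_pos a_pos \<open>B \<ge> 0\<close> by (intro mult_pos_pos prod_pos) (simp_all add: add_nonneg_pos less_imp_le)
  show ?thesis
  proof (rule that[of \<rho> \<xi>])
    have "(\<integral>\<^sup>+p. cost (fst p) (snd p) \<partial>\<xi>) + ennreal (convexity_const CARD('n) d B \<beta> * (measure \<theta> UNIV)\<^sup>2)
      \<le> (\<integral>\<^sup>+p. cost (fst p) (snd p) \<partial>\<xi>)
      + ennreal (d / (32 * \<beta> * (v * (\<Prod>j\<in>UNIV. 2 * B / a j + 2))) * (measure \<theta> UNIV)\<^sup>2)"
    proof -
      have "convexity_const CARD('n) d B \<beta> \<le> d / (32 * \<beta> * (v * (\<Prod>j\<in>UNIV. 2 * B / a j + 2)))"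
        unfolding convexity_const_def
      proof (rule frac_le)
        show "0 < 32 * \<beta> * (v * (\<Prod>j\<in>UNIV. 2 * B / a j + 2))"
          by (rule mult_pos_pos[OF _ vN_pos]) (use \<beta>(1) in simp)
        show "32 * \<beta> * (v * (\<Prod>j\<in>UNIV. 2 * B / a j + 2))
            \<le> 32 * \<beta> * ((2 * B + 2) ^ (CARD('n) - 1) * (2 * B / d + 2))"
          by (rule mult_left_mono[OF vN]) (use \<beta>(1) in simp)
      qed (use \<open>d > 0\<close> in auto)
      then show ?thesis
        by (intro add_left_mono ennreal_leI mult_right_mono) auto
    qed
    also have "\<dots> \<le> (\<integral>\<^sup>+p. ennreal (\<rho> (fst p)) * ennreal (cost (fst p) (snd p)) \<partial>\<theta>)
      + ennreal (2 * real CARD('n) * B * \<tau> * measure \<theta> UNIV)"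
      using \<beta> \<kappa> \<tau> \<open>d > 0\<close> \<open>B \<ge> 0\<close> conc by (intro exchange_cost) (auto simp: a_def)
    also have "\<dots> \<le> (\<integral>\<^sup>+p. ennreal (\<rho> (fst p)) * ennreal (cost (fst p) (snd p)) \<partial>\<theta>) + ennreal \<epsilon>"
      using E\<tau> by (intro add_left_mono ennreal_leI) (simp add: E_def algebra_simps)
    finally show "(\<integral>\<^sup>+p. cost (fst p) (snd p) \<partial>\<xi>) + ennreal (convexity_const CARD('n) d B \<beta> * (measure \<theta> UNIV)\<^sup>2)
      \<le> (\<integral>\<^sup>+p. ennreal (\<rho> (fst p)) * ennreal (cost (fst p) (snd p)) \<partial>\<theta>) + ennreal \<epsilon>" .
  qed (use \<rho>_nonneg \<rho>_le_1 \<xi>_fst_le \<xi>_snd \<kappa> in auto)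
qed

section \<open>Strong convexity of the cost in the mass\<close>

text \<open>The bound by \<open>\<beta>\<close> gives the first marginals densities
  \<open>D0\<close> and \<open>D1\<close>, and \<open>\<omega>\<close> is the relative excess of
  \<open>D1\<close> over \<open>D0\<close>. Where \<open>D0 < D1\<close>, the densities satisfy
  \<open>D0 + D1 + \<omega> * D1 = 2 * D1\<close>; elsewhere \<open>\<omega>\<close> vanishes and
  \<open>D0 + D1\<close> remains. So the average plan has room for a second copy of the
  excess.\<close>

lemma slack_weight:
  fixes \<gamma>0 \<gamma>1 :: "('a::euclidean_space \<times> 'a) measure" and F :: "'a set \<Rightarrow> ennreal"
  assumes sets0: "sets \<gamma>0 = sets borel" and sets1: "sets \<gamma>1 = sets borel"
    and le0: "\<And>A. A \<in> sets borel \<Longrightarrow> emeasure \<gamma>0 (A \<times> UNIV) \<le> F A"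
    and le1: "\<And>A. A \<in> sets borel \<Longrightarrow> emeasure \<gamma>1 (A \<times> UNIV) \<le> F A"
    and split: "\<And>A P. A \<in> sets borel \<Longrightarrow> P \<in> sets borel \<Longrightarrow> F A = F (A \<inter> P) + F (A - P)"
    and dens: "\<And>A. A \<in> sets borel \<Longrightarrow> F A \<le> ennreal \<beta> * emeasure lborel A"
    and fin: "F UNIV < \<infinity>"
  obtains \<omega> :: "'a \<Rightarrow> real" where "\<omega> \<in> borel_measurable borel" "\<And>x. 0 \<le> \<omega> x" "\<And>x. \<omega> x \<le> 1"
    "\<And>A. A \<in> sets borel \<Longrightarrow> emeasure \<gamma>0 (A \<times> UNIV) + emeasure \<gamma>1 (A \<times> UNIV)
        + (\<integral>\<^sup>+p. ennreal (\<omega> (fst p)) * indicator (A \<times> UNIV) p \<partial>\<gamma>1) \<le> 2 * F A"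
    "emeasure \<gamma>1 UNIV \<le> emeasure \<gamma>0 UNIV + (\<integral>\<^sup>+p. ennreal (\<omega> (fst p)) \<partial>\<gamma>1)"
proof -
  have marg: "\<exists>D. D \<in> borel_measurable borel \<and> (\<forall>x. 0 \<le> D x) \<and>
      distr \<gamma> borel fst = density lborel (\<lambda>x. ennreal (D x)) \<and>
      (\<forall>A\<in>sets borel. emeasure \<gamma> (A \<times> UNIV) = emeasure (distr \<gamma> borel fst) A)"
    if sets: "sets \<gamma> = sets borel" and le: "\<And>A. A \<in> sets borel \<Longrightarrow> emeasure \<gamma> (A \<times> UNIV) \<le> F A"
    for \<gamma> :: "('a \<times> 'a) measure"
  proof -
    have sp: "space \<gamma> = UNIV"
      using sets_eq_imp_space_eq[OF sets] by simp
    have fst_m: "fst \<in> measurable \<gamma> (borel :: 'a measure)"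
      using sets by (simp add: borel_prod[symmetric] cong: measurable_cong_sets)
    have em: "emeasure (distr \<gamma> borel fst) A = emeasure \<gamma> (A \<times> UNIV)" if "A \<in> sets borel" for A
      using that fst_m by (subst emeasure_distr) (auto simp: sp intro!: arg_cong[where f="emeasure \<gamma>"])
    interpret N: finite_measure "distr \<gamma> borel fst"
    proof
      have "emeasure (distr \<gamma> borel fst) UNIV \<le> F UNIV"
        using em[of UNIV] le[of UNIV] by simp
      then show "emeasure (distr \<gamma> borel fst) (space (distr \<gamma> borel fst)) \<noteq> \<infinity>"
        using fin by (auto simp: top_unique)
    qed
    have ac: "absolutely_continuous lborel (distr \<gamma> borel fst)"
      unfolding absolutely_continuous_def
    proof
      fix A :: "'a set" assume "A \<in> null_sets lborel"
      then have A: "A \<in> sets borel" "emeasure lborel A = 0"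
        by (auto simp: null_sets_def)
      have "emeasure (distr \<gamma> borel fst) A \<le> ennreal \<beta> * emeasure lborel A"
        using em[OF A(1)] le[OF A(1)] dens[OF A(1)] by simp
      then show "A \<in> null_sets (distr \<gamma> borel fst)"
        using A by (simp add: null_sets_def)
    qed
    obtain D where D: "D \<in> borel_measurable lborel" "AE x in lborel. RN_deriv lborel (distr \<gamma> borel fst) x = ennreal (D x)"
        "\<And>x. 0 \<le> D x"
      using sigma_finite_measure.real_RN_deriv[OF sigma_finite_lborel N.finite_measure_axioms ac] by auto
    have "distr \<gamma> borel fst = density lborel (RN_deriv lborel (distr \<gamma> borel fst))"
      using ac by (subst sigma_finite_measure.density_RN_deriv[OF sigma_finite_lborel]) auto
    also have "\<dots> = density lborel (\<lambda>x. ennreal (D x))"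
      using D by (intro density_cong) auto
    finally show ?thesis
      using D em by (intro exI[of _ D]) auto
  qed
  obtain D0 where D0 [measurable]: "D0 \<in> borel_measurable borel" and D0p: "\<And>x. 0 \<le> D0 x"
    and D0d: "\<And>A. A \<in> sets borel \<Longrightarrow> emeasure \<gamma>0 (A \<times> UNIV) = emeasure (density lborel (\<lambda>x. ennreal (D0 x))) A"
    using marg[OF sets0 le0] by metis
  obtain D1 where D1 [measurable]: "D1 \<in> borel_measurable borel" and D1p: "\<And>x. 0 \<le> D1 x"
    and D1e: "distr \<gamma>1 borel fst = density lborel (\<lambda>x. ennreal (D1 x))"
    and D1d: "\<And>A. A \<in> sets borel \<Longrightarrow> emeasure \<gamma>1 (A \<times> UNIV) = emeasure (density lborel (\<lambda>x. ennreal (D1 x))) A"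
    using marg[OF sets1 le1] by metis
  define \<omega> where "\<omega> x = (if D0 x < D1 x then (D1 x - D0 x) / D1 x else 0)" for x
  have \<omega>_m [measurable]: "\<omega> \<in> borel_measurable borel"
    unfolding \<omega>_def by measurable
  have \<omega>_pos: "0 \<le> \<omega> x" and \<omega>_le: "\<omega> x \<le> 1" for x
    using D0p[of x] D1p[of x] by (auto simp: \<omega>_def divide_le_eq_1)
  have D1\<omega>: "D1 x * \<omega> x = (if D0 x < D1 x then D1 x - D0 x else 0)" for x
    using D0p[of x] by (auto simp: \<omega>_def)
  have fst_m: "fst \<in> measurable \<gamma>1 (borel :: 'a measure)"
    using sets1 by (simp add: borel_prod[symmetric] cong: measurable_cong_sets)
  have int\<omega>: "(\<integral>\<^sup>+p. ennreal (\<omega> (fst p)) * indicator (A \<times> UNIV) p \<partial>\<gamma>1)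
      = (\<integral>\<^sup>+x. ennreal (D1 x * \<omega> x) * indicator A x \<partial>lborel)" if [measurable]: "A \<in> sets borel" for A
  proof -
    have "(\<integral>\<^sup>+p. ennreal (\<omega> (fst p)) * indicator (A \<times> UNIV) p \<partial>\<gamma>1)
        = (\<integral>\<^sup>+p. ennreal (\<omega> (fst p)) * indicator A (fst p) \<partial>\<gamma>1)"
      by (intro nn_integral_cong) (auto simp: indicator_def)
    also have "\<dots> = (\<integral>\<^sup>+x. ennreal (\<omega> x) * indicator A x \<partial>distr \<gamma>1 borel fst)"
      using fst_m by (subst nn_integral_distr) auto
    also have "\<dots> = (\<integral>\<^sup>+x. ennreal (D1 x) * (ennreal (\<omega> x) * indicator A x) \<partial>lborel)"
      unfolding D1e by (subst nn_integral_density) auto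
    also have "\<dots> = (\<integral>\<^sup>+x. ennreal (D1 x * \<omega> x) * indicator A x \<partial>lborel)"
      using D1p \<omega>_pos by (intro nn_integral_cong) (simp add: ennreal_mult mult.assoc)
    finally show ?thesis .
  qed
  have em0: "emeasure \<gamma>0 (A \<times> UNIV) = (\<integral>\<^sup>+x. ennreal (D0 x) * indicator A x \<partial>lborel)"
    and em1: "emeasure \<gamma>1 (A \<times> UNIV) = (\<integral>\<^sup>+x. ennreal (D1 x) * indicator A x \<partial>lborel)"
    if "A \<in> sets borel" for A
    using that by (auto simp: D0d D1d emeasure_density)
  define P where "P = {x. D0 x < D1 x}"
  have P [measurable]: "P \<in> sets borel"
    unfolding P_def by measurable
  define X where "X A = emeasure \<gamma>0 (A \<times> UNIV) + emeasure \<gamma>1 (A \<times> UNIV)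
        + (\<integral>\<^sup>+p. ennreal (\<omega> (fst p)) * indicator (A \<times> UNIV) p \<partial>\<gamma>1)" for A
  have XP: "X A \<le> 2 * F A" if A [measurable]: "A \<in> sets borel" and "A \<subseteq> P" for A
  proof -
    have "emeasure \<gamma>0 (A \<times> UNIV) + (\<integral>\<^sup>+p. ennreal (\<omega> (fst p)) * indicator (A \<times> UNIV) p \<partial>\<gamma>1)
        = (\<integral>\<^sup>+x. ennreal (D0 x) * indicator A x + ennreal (D1 x * \<omega> x) * indicator A x \<partial>lborel)"
      by (subst nn_integral_add) (auto simp: em0 int\<omega>)
    also have "\<dots> = emeasure \<gamma>1 (A \<times> UNIV)"
      unfolding em1[OF A] using \<open>A \<subseteq> P\<close> D0p
      by (intro nn_integral_cong) (auto simp: indicator_def D1\<omega> P_def simp flip: ennreal_plus)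
    finally have "X A = emeasure \<gamma>1 (A \<times> UNIV) + emeasure \<gamma>1 (A \<times> UNIV)"
      unfolding X_def by (simp add: ac_simps)
    also have "\<dots> \<le> F A + F A"
      by (intro add_mono le1 A)
    finally show ?thesis
      by (simp add: mult_2)
  qed
  have XQ: "X A \<le> 2 * F A" if A [measurable]: "A \<in> sets borel" and "A \<inter> P = {}" for A
  proof -
    have "(\<integral>\<^sup>+x. ennreal (D1 x * \<omega> x) * indicator A x \<partial>lborel) = (\<integral>\<^sup>+x. 0 \<partial>(lborel :: 'a measure))"
      using \<open>A \<inter> P = {}\<close> by (intro nn_integral_cong) (auto simp: indicator_def D1\<omega> P_def)
    then have "X A = emeasure \<gamma>0 (A \<times> UNIV) + emeasure \<gamma>1 (A \<times> UNIV)"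
      unfolding X_def by (simp add: int\<omega>)
    also have "\<dots> \<le> F A + F A"
      by (intro add_mono le1 le0 A)
    finally show ?thesis
      by (simp add: mult_2)
  qed
  show ?thesis
  proof (rule that[of \<omega>])
    fix A :: "'a set" assume A [measurable]: "A \<in> sets borel"
    have add: "(\<integral>\<^sup>+x. h x * indicator A x \<partial>lborel)
        = (\<integral>\<^sup>+x. h x * indicator (A \<inter> P) x \<partial>lborel) + (\<integral>\<^sup>+x. h x * indicator (A - P) x \<partial>lborel)"
      if [measurable]: "h \<in> borel_measurable borel" for h :: "'a \<Rightarrow> ennreal"
      by (subst nn_integral_add[symmetric]) (auto simp: indicator_def intro!: nn_integral_cong)
    have X_alt: "X A = (\<integral>\<^sup>+x. ennreal (D0 x) * indicator A x \<partial>lborel)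
        + (\<integral>\<^sup>+x. ennreal (D1 x) * indicator A x \<partial>lborel)
        + (\<integral>\<^sup>+x. ennreal (D1 x * \<omega> x) * indicator A x \<partial>lborel)" if "A \<in> sets borel" for A
      unfolding X_def em0[OF that] em1[OF that] int\<omega>[OF that] ..
    have sets_AP: "A \<inter> P \<in> sets borel" "A - P \<in> sets borel"
      by auto
    have meas: "(\<lambda>x. ennreal (D0 x)) \<in> borel_measurable borel" "(\<lambda>x. ennreal (D1 x)) \<in> borel_measurable borel"
        "(\<lambda>x. ennreal (D1 x * \<omega> x)) \<in> borel_measurable borel"
      by measurable
    \<comment> \<open>\<open>F\<close> is only assumed to be additive under a cut, so the two cases
      are joined by cutting \<open>A\<close> along \<open>P\<close>.\<close>
    have "X A = X (A \<inter> P) + X (A - P)"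
      unfolding X_alt[OF A] X_alt[OF sets_AP(1)] X_alt[OF sets_AP(2)] meas[THEN add]
      by (simp only: ac_simps)
    also have "\<dots> \<le> 2 * F (A \<inter> P) + 2 * F (A - P)"
      by (intro add_mono XP XQ) auto
    also have "\<dots> = 2 * F A"
      using split[OF A P] by (simp add: distrib_left)
    finally show "emeasure \<gamma>0 (A \<times> UNIV) + emeasure \<gamma>1 (A \<times> UNIV)
        + (\<integral>\<^sup>+p. ennreal (\<omega> (fst p)) * indicator (A \<times> UNIV) p \<partial>\<gamma>1) \<le> 2 * F A"
      unfolding X_def .
  next
    have "emeasure \<gamma>1 UNIV = (\<integral>\<^sup>+x. ennreal (D1 x) * indicator UNIV x \<partial>lborel)"
      using em1[of UNIV] by simp
    also have "\<dots> \<le> (\<integral>\<^sup>+x. ennreal (D0 x) * indicator UNIV x + ennreal (D1 x * \<omega> x) * indicator UNIV x \<partial>lborel)"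
      using D0p by (intro nn_integral_mono) (auto simp: D1\<omega> simp flip: ennreal_plus intro!: ennreal_leI)
    also have "\<dots> = (\<integral>\<^sup>+x. ennreal (D0 x) * indicator UNIV x \<partial>lborel) + (\<integral>\<^sup>+x. ennreal (D1 x * \<omega> x) * indicator UNIV x \<partial>lborel)"
      by (rule nn_integral_add) auto
    also have "\<dots> = emeasure \<gamma>0 UNIV + (\<integral>\<^sup>+p. ennreal (\<omega> (fst p)) \<partial>\<gamma>1)"
      using em0[of UNIV] int\<omega>[of UNIV] by simp
    finally show "emeasure \<gamma>1 UNIV \<le> emeasure \<gamma>0 UNIV + (\<integral>\<^sup>+p. ennreal (\<omega> (fst p)) \<partial>\<gamma>1)" .
  qed (use \<omega>_pos \<omega>_le in auto)
qed

lemma sum_le_imp_ex_ge: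
  fixes h :: "'a \<Rightarrow> real"
  assumes "finite S" "S \<noteq> {}" "H \<le> sum h S"
  shows "\<exists>x\<in>S. H / card S \<le> h x"
proof (rule ccontr)
  assume "\<not> ?thesis"
  then have "sum h S < (\<Sum>x\<in>S. H / card S)"
    using assms by (intro sum_strict_mono) (auto simp: not_le)
  then show False
    using assms by simp
qed

text \<open>The norm is at most the sum of the absolute coordinates, so the largest of them is at
  least its average share.\<close>

lemma norm_ge_imp_component_ge:
  fixes x :: "real^'n"
  assumes "\<delta> \<le> norm x"
  shows "\<exists>i. \<delta> / CARD('n) \<le> \<bar>x$i\<bar>"
  using sum_le_imp_ex_ge[of "UNIV :: 'n set" \<delta> "\<lambda>i. \<bar>x$i\<bar>"] norm_le_l1_cart[of x] assms by auto

text \<open>The plan is the average of \<open>\<gamma>0\<close> and a modified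
  \<open>\<gamma>1\<close>, in which part of the excess over \<open>\<gamma>0\<close> is rerouted by
  \<open>exchange_exists\<close> within the room found by \<open>slack_weight\<close>. Endpoints and
  total mass are unchanged; \<open>\<epsilon>\<close> pays for the positive width of the
  tubes.\<close>

lemma strong_convexity:
  fixes \<gamma>0 \<gamma>1 :: "((real^'n) \<times> (real^'n)) measure" and F G :: "(real^'n) set \<Rightarrow> ennreal"
  assumes sets0: "sets \<gamma>0 = sets borel" and sets1: "sets \<gamma>1 = sets borel"
    and le0: "\<And>A. A \<in> sets borel \<Longrightarrow> emeasure \<gamma>0 (A \<times> UNIV) \<le> F A"
    and le1: "\<And>A. A \<in> sets borel \<Longrightarrow> emeasure \<gamma>1 (A \<times> UNIV) \<le> F A"
    and le0': "\<And>A. A \<in> sets borel \<Longrightarrow> emeasure \<gamma>0 (UNIV \<times> A) \<le> G A"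
    and le1': "\<And>A. A \<in> sets borel \<Longrightarrow> emeasure \<gamma>1 (UNIV \<times> A) \<le> G A"
    and split: "\<And>A P. A \<in> sets borel \<Longrightarrow> P \<in> sets borel \<Longrightarrow> F A = F (A \<inter> P) + F (A - P)"
    and dens: "\<And>A. A \<in> sets borel \<Longrightarrow> F A \<le> ennreal \<beta> * emeasure lborel A"
    and fin: "F UNIV < \<infinity>"
    and pos: "\<beta> > 0" "B \<ge> 0" "\<delta> > 0" "\<epsilon> > 0"
    and conc: "AE p in \<gamma>1. (\<forall>j. \<bar>fst p$j\<bar> \<le> B) \<and> (\<forall>j. \<bar>snd p$j\<bar> \<le> B) \<and> \<delta> \<le> norm (fst p - snd p)"
    and mass: "measure \<gamma>0 UNIV \<le> measure \<gamma>1 UNIV"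
  obtains \<gamma> where "sets \<gamma> = sets borel"
    "\<And>A. A \<in> sets borel \<Longrightarrow> emeasure \<gamma> (A \<times> UNIV) \<le> F A"
    "\<And>A. A \<in> sets borel \<Longrightarrow> emeasure \<gamma> (UNIV \<times> A) \<le> G A"
    "2 * emeasure \<gamma> UNIV = emeasure \<gamma>0 UNIV + emeasure \<gamma>1 UNIV"
    "2 * (\<integral>\<^sup>+p. cost (fst p) (snd p) \<partial>\<gamma>)
      + ennreal (convexity_const CARD('n) (\<delta> / CARD('n)) B \<beta> / (2 * CARD('n))\<^sup>2 * (measure \<gamma>1 UNIV - measure \<gamma>0 UNIV)\<^sup>2)
      \<le> (\<integral>\<^sup>+p. cost (fst p) (snd p) \<partial>\<gamma>0) + (\<integral>\<^sup>+p. cost (fst p) (snd p) \<partial>\<gamma>1) + ennreal \<epsilon>"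
proof -
  define n where "n = real CARD('n)"
  have n: "n > 0"
    by (simp add: n_def)
  define d where "d = \<delta> / n"
  have d: "d > 0"
    using pos n by (simp add: d_def)
  have s1 [measurable_cong]: "sets \<gamma>1 = sets (borel \<Otimes>\<^sub>M borel)"
    unfolding borel_prod by (rule sets1)
  have sp0: "space \<gamma>0 = UNIV" and sp1: "space \<gamma>1 = UNIV"
    using sets_eq_imp_space_eq[OF sets0] sets_eq_imp_space_eq[OF sets1] by auto
  have "emeasure \<gamma>0 UNIV < \<infinity>" "emeasure \<gamma>1 UNIV < \<infinity>"
    using le0[of UNIV] le1[of UNIV] fin by (auto intro: le_less_trans)
  then interpret \<gamma>0: finite_measure \<gamma>0 + \<gamma>1: finite_measure \<gamma>1
    by (auto intro!: finite_measureI simp: sp0 sp1)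
  have cost_m [measurable]: "(\<lambda>p. cost (fst p) (snd p)) \<in> borel_measurable ((borel :: (real^'n) measure) \<Otimes>\<^sub>M borel)"
    unfolding borel_prod by (rule cost_measurable)
  obtain \<omega> where \<omega> [measurable]: "\<omega> \<in> borel_measurable borel" and \<omega>_pos: "\<And>x. 0 \<le> \<omega> x" and \<omega>_le: "\<And>x. \<omega> x \<le> 1"
    and slack: "\<And>A. A \<in> sets borel \<Longrightarrow> emeasure \<gamma>0 (A \<times> UNIV) + emeasure \<gamma>1 (A \<times> UNIV)
        + (\<integral>\<^sup>+p. ennreal (\<omega> (fst p)) * indicator (A \<times> UNIV) p \<partial>\<gamma>1) \<le> 2 * F A"
    and \<omega>_mass: "emeasure \<gamma>1 UNIV \<le> emeasure \<gamma>0 UNIV + (\<integral>\<^sup>+p. ennreal (\<omega> (fst p)) \<partial>\<gamma>1)"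
  proof (rule slack_weight[of \<gamma>0 \<gamma>1 F \<beta>], goal_cases)
    case (8 \<omega>)
    show ?case
      by (rule 8(1)[of \<omega>]) (fact 8)+
  qed (erule le0 le1 dens | rule sets0 sets1 fin | (erule split, assumption))+
  \<comment> \<open>\<open>V i s\<close> selects the excess mass that travels at least
    \<open>d\<close> in the signed direction \<open>s\<close> times the \<open>i\<close>-th unit
    vector.\<close>
  define V :: "'n \<Rightarrow> real \<Rightarrow> (real^'n) \<times> (real^'n) \<Rightarrow> real"
    where "V i s p = (if d \<le> s * (snd p$i - fst p$i) then \<omega> (fst p) else 0)" for i s p
  have V_m [measurable]: "V i s \<in> borel_measurable (borel \<Otimes>\<^sub>M borel)" for i s
    unfolding V_def by measurable
  have V_pos: "0 \<le> V i s p" and V_le: "V i s p \<le> \<omega> (fst p)" for i s p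
    using \<omega>_pos by (auto simp: V_def)
  define S where "S = (UNIV :: 'n set) \<times> {1, -1 :: real}"
  have S: "finite S" "S \<noteq> {}" "card S = 2 * CARD('n)"
    by (auto simp: S_def card_cartesian_product)
  have fin_V: "(\<integral>\<^sup>+p. ennreal (V i s p) \<partial>\<gamma>1) < \<infinity>" for i s
  proof -
    have "(\<integral>\<^sup>+p. ennreal (V i s p) \<partial>\<gamma>1) \<le> (\<integral>\<^sup>+p. 1 \<partial>\<gamma>1)"
      using order_trans[OF V_le \<omega>_le] by (intro nn_integral_mono) auto
    also have "\<dots> < \<infinity>"
      by (simp add: \<gamma>1.emeasure_eq_measure)
    finally show ?thesis .
  qed
  \<comment> \<open>Every pair charged by \<open>\<gamma>1\<close> is selected in at least one of
    the \<open>2 * CARD('n)\<close> signed directions, so one direction carries at least the average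
    share of the excess.\<close>
  have "\<exists>x\<in>S. (measure \<gamma>1 UNIV - measure \<gamma>0 UNIV) / card S
      \<le> enn2real (\<integral>\<^sup>+p. ennreal (V (fst x) (snd x) p) \<partial>\<gamma>1)"
  proof (rule sum_le_imp_ex_ge[OF S(1,2)])
    have "(\<integral>\<^sup>+p. ennreal (\<omega> (fst p)) \<partial>\<gamma>1) \<le> (\<integral>\<^sup>+p. (\<Sum>x\<in>S. ennreal (V (fst x) (snd x) p)) \<partial>\<gamma>1)"
    proof (rule nn_integral_mono_AE, rule AE_mp[OF conc], rule AE_I2, rule impI)
      fix p :: "(real^'n) \<times> (real^'n)"
      assume p: "(\<forall>j. \<bar>fst p$j\<bar> \<le> B) \<and> (\<forall>j. \<bar>snd p$j\<bar> \<le> B) \<and> \<delta> \<le> norm (fst p - snd p)"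
      then obtain i where i: "d \<le> \<bar>fst p$i - snd p$i\<bar>"
        using norm_ge_imp_component_ge[of \<delta> "fst p - snd p"] by (auto simp: d_def n_def)
      define s :: real where "s = (if fst p$i \<le> snd p$i then 1 else -1)"
      have "ennreal (\<omega> (fst p)) = ennreal (V (fst (i, s)) (snd (i, s)) p)"
        using i by (auto simp: V_def s_def)
      also have "\<dots> \<le> (\<Sum>x\<in>S. ennreal (V (fst x) (snd x) p))"
        using S(1) by (intro member_le_sum) (auto simp: S_def s_def)
      finally show "ennreal (\<omega> (fst p)) \<le> (\<Sum>x\<in>S. ennreal (V (fst x) (snd x) p))" .
    qed
    also have "\<dots> = (\<Sum>x\<in>S. \<integral>\<^sup>+p. ennreal (V (fst x) (snd x) p) \<partial>\<gamma>1)"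
      by (rule nn_integral_sum) measurable
    also have "\<dots> = (\<Sum>x\<in>S. ennreal (enn2real (\<integral>\<^sup>+p. ennreal (V (fst x) (snd x) p) \<partial>\<gamma>1)))"
      using fin_V by (intro sum.cong) (auto simp: less_top)
    also have "\<dots> = ennreal (\<Sum>x\<in>S. enn2real (\<integral>\<^sup>+p. ennreal (V (fst x) (snd x) p) \<partial>\<gamma>1))"
      by (intro sum_ennreal) auto
    finally have "ennreal (measure \<gamma>1 UNIV) \<le> ennreal (measure \<gamma>0 UNIV)
        + ennreal (\<Sum>x\<in>S. enn2real (\<integral>\<^sup>+p. ennreal (V (fst x) (snd x) p) \<partial>\<gamma>1))"
      using \<omega>_mass by (simp add: \<gamma>0.emeasure_eq_measure \<gamma>1.emeasure_eq_measure) (meson add_left_mono order_trans)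
    note le = this
    have nonneg: "0 \<le> (\<Sum>x\<in>S. enn2real (\<integral>\<^sup>+p. ennreal (V (fst x) (snd x) p) \<partial>\<gamma>1))"
      by (intro sum_nonneg) simp
    have "measure \<gamma>1 UNIV \<le> measure \<gamma>0 UNIV
        + (\<Sum>x\<in>S. enn2real (\<integral>\<^sup>+p. ennreal (V (fst x) (snd x) p) \<partial>\<gamma>1))"
      using le unfolding ennreal_plus[OF measure_nonneg nonneg, symmetric]
      by (rule ennreal_le_iff[THEN iffD1, rotated]) (intro add_nonneg_nonneg measure_nonneg nonneg)
    then show "measure \<gamma>1 UNIV - measure \<gamma>0 UNIV
        \<le> (\<Sum>x\<in>S. enn2real (\<integral>\<^sup>+p. ennreal (V (fst x) (snd x) p) \<partial>\<gamma>1))"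
      by simp
  qed
  then obtain i s where s: "s = 1 \<or> s = -1"
    and share: "(measure \<gamma>1 UNIV - measure \<gamma>0 UNIV) / (2 * n) \<le> enn2real (\<integral>\<^sup>+p. ennreal (V i s p) \<partial>\<gamma>1)"
    using S(3) by (auto simp: S_def n_def)
  define W where "W = V i s"
  have W_m [measurable]: "W \<in> borel_measurable (borel \<Otimes>\<^sub>M borel)"
    and W_pos: "\<And>p. 0 \<le> W p" and W_le: "\<And>p. W p \<le> \<omega> (fst p)" and W_1: "\<And>p. W p \<le> 1"
    using V_m V_pos V_le order_trans[OF V_le \<omega>_le] by (auto simp: W_def)
  define \<theta> where "\<theta> = density \<gamma>1 (\<lambda>p. ennreal (W p))"
  have sets_\<theta>: "sets \<theta> = sets borel"
    using sets1 by (simp add: \<theta>_def)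
  have em_\<theta>: "emeasure \<theta> A = (\<integral>\<^sup>+p. ennreal (W p) * indicator A p \<partial>\<gamma>1)" if "A \<in> sets borel" for A
    unfolding \<theta>_def using that sets1 by (intro emeasure_density) auto
  have \<theta>_UNIV: "emeasure \<theta> UNIV = (\<integral>\<^sup>+p. ennreal (V i s p) \<partial>\<gamma>1)"
    using em_\<theta>[of UNIV] by (simp add: W_def)
  have fin_\<theta>: "finite_measure \<theta>"
    using fin_V[of i s] sp1 by (intro finite_measureI) (simp add: \<theta>_UNIV[symmetric] \<theta>_def)
  have box1: "A \<times> UNIV \<in> sets (borel :: ((real^'n) \<times> (real^'n)) measure)"
    and box2: "UNIV \<times> A \<in> sets (borel :: ((real^'n) \<times> (real^'n)) measure)"
    if "A \<in> sets borel" for A :: "(real^'n) set"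
    using that unfolding borel_prod[symmetric] by auto
  have \<theta>_dens: "emeasure \<theta> (A \<times> UNIV) \<le> ennreal \<beta> * emeasure lborel A" if A: "A \<in> sets borel" for A
  proof -
    have "emeasure \<theta> (A \<times> UNIV) \<le> (\<integral>\<^sup>+p. indicator (A \<times> UNIV) p \<partial>\<gamma>1)"
      unfolding em_\<theta>[OF box1[OF A]] using W_1
      by (intro nn_integral_mono) (auto simp: indicator_def)
    also have "\<dots> = emeasure \<gamma>1 (A \<times> UNIV)"
      using box1[OF A] sets1 by simp
    finally show ?thesis
      using le1[OF A] dens[OF A] by order
  qed
  have conc_\<theta>: "AE p in \<theta>. (\<forall>j. \<bar>fst p$j\<bar> \<le> B) \<and> (\<forall>j. \<bar>snd p$j\<bar> \<le> B) \<and> d \<le> s * (snd p$i - fst p$i)"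
  proof -
    have "AE p in \<gamma>1. 0 < ennreal (W p) \<longrightarrow>
        (\<forall>j. \<bar>fst p$j\<bar> \<le> B) \<and> (\<forall>j. \<bar>snd p$j\<bar> \<le> B) \<and> d \<le> s * (snd p$i - fst p$i)"
      by (rule eventually_mono[OF conc]) (auto simp: W_def V_def split: if_splits)
    then show ?thesis
      unfolding \<theta>_def by (subst AE_density) auto
  qed
  obtain \<rho> \<xi> where \<rho> [measurable]: "\<rho> \<in> borel_measurable borel" and \<rho>_pos: "\<And>x. 0 \<le> \<rho> x" and \<rho>_le: "\<And>x. \<rho> x \<le> 1"
    and sets_\<xi>: "sets \<xi> = sets borel"
    and \<xi>1: "\<And>A. A \<in> sets borel \<Longrightarrow> emeasure \<xi> (A \<times> UNIV) \<le> emeasure \<theta> (A \<times> UNIV)"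
    and \<xi>2: "\<And>A. A \<in> sets borel \<Longrightarrow>
      emeasure \<xi> (UNIV \<times> A) = (\<integral>\<^sup>+p. ennreal (\<rho> (fst p)) * indicator (UNIV \<times> A) p \<partial>\<theta>)"
    and \<xi>c: "(\<integral>\<^sup>+p. cost (fst p) (snd p) \<partial>\<xi>) + ennreal (convexity_const CARD('n) d B \<beta> * (measure \<theta> UNIV)\<^sup>2)
      \<le> (\<integral>\<^sup>+p. ennreal (\<rho> (fst p)) * ennreal (cost (fst p) (snd p)) \<partial>\<theta>) + ennreal \<epsilon>"
  proof (rule exchange_exists[of \<theta> s \<beta> B d \<epsilon> i], goal_cases)
    case (10 \<rho> \<xi>)
    show ?case
      by (rule 10(1)[of \<rho> \<xi>]) (fact 10)+
  qed (erule \<theta>_dens | rule fin_\<theta> sets_\<theta> s pos d conc_\<theta>)+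
  \<comment> \<open>What is left of \<open>\<gamma>1\<close> once the fraction \<open>\<rho>\<close>
    of \<open>\<theta>\<close> has been taken away; \<open>\<xi>\<close> will replace the part
    removed.\<close>
  define \<eta> where "\<eta> = density \<gamma>1 (\<lambda>p. ennreal (1 - W p * \<rho> (fst p)))"
  have sets_\<eta>: "sets \<eta> = sets borel"
    using sets1 by (simp add: \<eta>_def)
  have W\<rho>: "0 \<le> W p * \<rho> (fst p)" "W p * \<rho> (fst p) \<le> 1" for p
    using W_pos[of p] W_1[of p] \<rho>_pos[of "fst p"] \<rho>_le[of "fst p"] by (auto intro: mult_le_one)
  have balance: "(\<integral>\<^sup>+p. h p \<partial>\<eta>) + (\<integral>\<^sup>+p. ennreal (\<rho> (fst p)) * h p \<partial>\<theta>) = (\<integral>\<^sup>+p. h p \<partial>\<gamma>1)"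
    if h [measurable]: "h \<in> borel_measurable (borel \<Otimes>\<^sub>M borel)" for h
  proof -
    have "(\<integral>\<^sup>+p. h p \<partial>\<eta>) + (\<integral>\<^sup>+p. ennreal (\<rho> (fst p)) * h p \<partial>\<theta>)
      = (\<integral>\<^sup>+p. ennreal (1 - W p * \<rho> (fst p)) * h p + ennreal (W p) * (ennreal (\<rho> (fst p)) * h p) \<partial>\<gamma>1)"
      unfolding \<eta>_def \<theta>_def by (simp add: nn_integral_density nn_integral_add)
    also have "\<dots> = (\<integral>\<^sup>+p. h p \<partial>\<gamma>1)"
    proof (rule nn_integral_cong)
      fix p
      have "ennreal (1 - W p * \<rho> (fst p)) + ennreal (W p) * ennreal (\<rho> (fst p)) = 1"
        using W\<rho>[of p] W_pos[of p] \<rho>_pos[of "fst p"] by (simp flip: ennreal_mult ennreal_plus)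
      then show "ennreal (1 - W p * \<rho> (fst p)) * h p + ennreal (W p) * (ennreal (\<rho> (fst p)) * h p) = h p"
        by (metis distrib_right mult.assoc mult_1)
    qed
    finally show ?thesis .
  qed
  \<comment> \<open>The estimates are made for the doubled plan; halving comes last and avoids
    division of extended reals.\<close>
  define \<Gamma> where "\<Gamma> = plus_measure \<gamma>0 (plus_measure \<eta> \<xi>)"
  have sets_in: "sets (plus_measure \<eta> \<xi>) = sets \<gamma>0"
    by (simp add: sets_plus_measure sets_\<eta> sets_\<xi> sets0)
  have sets_\<Gamma>: "sets \<Gamma> = sets borel"
    unfolding \<Gamma>_def by (simp add: sets_plus_measure sets_in sets0)
  have em_\<Gamma>: "emeasure \<Gamma> A = emeasure \<gamma>0 A + (emeasure \<eta> A + emeasure \<xi> A)" if "A \<in> sets borel" for A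
    unfolding \<Gamma>_def using that
    by (simp add: emeasure_plus_measure sets_in sets0 sets_\<eta> sets_\<xi>)
  have balance_em: "emeasure \<eta> (UNIV \<times> A) + emeasure \<xi> (UNIV \<times> A) = emeasure \<gamma>1 (UNIV \<times> A)"
    if A [measurable]: "A \<in> sets borel" for A
  proof -
    have "emeasure \<eta> (UNIV \<times> A) + emeasure \<xi> (UNIV \<times> A)
        = (\<integral>\<^sup>+p. indicator (UNIV \<times> A) p \<partial>\<eta>) + (\<integral>\<^sup>+p. ennreal (\<rho> (fst p)) * indicator (UNIV \<times> A) p \<partial>\<theta>)"
      using box2[OF A] unfolding \<xi>2[OF A] sets_\<eta>[symmetric] by simp
    also have "\<dots> = (\<integral>\<^sup>+p. indicator (UNIV \<times> A) p \<partial>\<gamma>1)"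
      by (rule balance) measurable
    also have "\<dots> = emeasure \<gamma>1 (UNIV \<times> A)"
      using box2[OF A] unfolding sets1[symmetric] by simp
    finally show ?thesis .
  qed
  define \<gamma> where "\<gamma> = scale_measure (ennreal (1/2)) \<Gamma>"
  have half: "ennreal (1/2) * (2 * x) = x" "2 * (ennreal (1/2) * x) = x" for x
  proof -
    have h: "ennreal (1/2) * 2 = 1"
      using ennreal_mult[of "1/2" 2] by simp
    show "ennreal (1/2) * (2 * x) = x"
      by (simp only: mult.assoc[symmetric] h mult_1)
    show "2 * (ennreal (1/2) * x) = x"
      by (simp only: mult.assoc[symmetric] mult.commute[of 2] h mult_1)
  qed
  show ?thesis
  proof (rule that[of \<gamma>])
    show "sets \<gamma> = sets borel"
      by (simp add: \<gamma>_def sets_\<Gamma>)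
    show "emeasure \<gamma> (A \<times> UNIV) \<le> F A" if A: "A \<in> sets borel" for A
    proof -
      have "emeasure \<eta> (A \<times> UNIV) = (\<integral>\<^sup>+p. ennreal (1 - W p * \<rho> (fst p)) * indicator (A \<times> UNIV) p \<partial>\<gamma>1)"
        unfolding \<eta>_def using box1[OF A] sets1 by (intro emeasure_density) auto
      also have "\<dots> \<le> (\<integral>\<^sup>+p. indicator (A \<times> UNIV) p \<partial>\<gamma>1)"
        using W\<rho> by (intro nn_integral_mono) (simp add: indicator_def)
      also have "\<dots> = emeasure \<gamma>1 (A \<times> UNIV)"
        using box1[OF A] sets1 by simp
      finally have 1: "emeasure \<eta> (A \<times> UNIV) \<le> emeasure \<gamma>1 (A \<times> UNIV)" .
      have 2: "emeasure \<xi> (A \<times> UNIV) \<le> (\<integral>\<^sup>+p. ennreal (\<omega> (fst p)) * indicator (A \<times> UNIV) p \<partial>\<gamma>1)"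
        using W_le
        by (intro order_trans[OF \<xi>1[OF A]], unfold em_\<theta>[OF box1[OF A]], intro nn_integral_mono mult_right_mono)
          (auto intro: ennreal_leI)
      \<comment> \<open>The departures from \<open>\<gamma>1\<close> are not credited: all of its
        marginal together with the arrivals, which are at most the \<open>\<omega>\<close> part,
        fits below \<open>2 * F A\<close>.\<close>
      have "emeasure \<Gamma> (A \<times> UNIV) \<le> emeasure \<gamma>0 (A \<times> UNIV) + (emeasure \<gamma>1 (A \<times> UNIV)
          + (\<integral>\<^sup>+p. ennreal (\<omega> (fst p)) * indicator (A \<times> UNIV) p \<partial>\<gamma>1))"
        unfolding em_\<Gamma>[OF box1[OF A]] by (intro add_mono 1 2) auto
      also have "\<dots> \<le> 2 * F A"
        using slack[OF A] by (simp add: add.assoc)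
      finally have "ennreal (1/2) * emeasure \<Gamma> (A \<times> UNIV) \<le> ennreal (1/2) * (2 * F A)"
        by (rule mult_left_mono) simp
      then show ?thesis
        unfolding half by (simp add: \<gamma>_def)
    qed
    show "emeasure \<gamma> (UNIV \<times> A) \<le> G A" if A: "A \<in> sets borel" for A
    proof -
      have "emeasure \<Gamma> (UNIV \<times> A) = emeasure \<gamma>0 (UNIV \<times> A) + emeasure \<gamma>1 (UNIV \<times> A)"
        unfolding em_\<Gamma>[OF box2[OF A]] balance_em[OF A] ..
      also have "\<dots> \<le> G A + G A"
        by (intro add_mono le0' le1' A)
      finally have "ennreal (1/2) * emeasure \<Gamma> (UNIV \<times> A) \<le> ennreal (1/2) * (2 * G A)"
        unfolding mult_2 by (rule mult_left_mono) simp
      then show ?thesis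
        unfolding half by (simp add: \<gamma>_def)
    qed
    have "2 * emeasure \<gamma> UNIV = emeasure \<Gamma> UNIV"
      unfolding \<gamma>_def emeasure_scale_measure half ..
    then show "2 * emeasure \<gamma> UNIV = emeasure \<gamma>0 UNIV + emeasure \<gamma>1 UNIV"
      using em_\<Gamma>[of UNIV] balance_em[of UNIV] by simp
    have c_m: "(\<lambda>p. ennreal (cost (fst p) (snd p))) \<in> borel_measurable M"
      if "sets M = sets (borel :: ((real^'n) \<times> (real^'n)) measure)" for M
      unfolding measurable_cong_sets[OF that refl] by (rule measurable_compose[OF cost_measurable measurable_ennreal])
    have "2 * (\<integral>\<^sup>+p. cost (fst p) (snd p) \<partial>\<gamma>) = (\<integral>\<^sup>+p. cost (fst p) (snd p) \<partial>\<Gamma>)"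
      unfolding \<gamma>_def nn_integral_scale_measure[OF c_m[OF sets_\<Gamma>]] half ..
    also have "\<dots> = (\<integral>\<^sup>+p. cost (fst p) (snd p) \<partial>\<gamma>0)
        + ((\<integral>\<^sup>+p. cost (fst p) (snd p) \<partial>\<eta>) + (\<integral>\<^sup>+p. cost (fst p) (snd p) \<partial>\<xi>))"
      unfolding \<Gamma>_def using sets_in sets0 sets_\<eta> sets_\<xi>
      by (simp add: nn_integral_plus_measure c_m)
    finally have cost\<gamma>: "2 * (\<integral>\<^sup>+p. cost (fst p) (snd p) \<partial>\<gamma>) = (\<integral>\<^sup>+p. cost (fst p) (snd p) \<partial>\<gamma>0)
        + ((\<integral>\<^sup>+p. cost (fst p) (snd p) \<partial>\<eta>) + (\<integral>\<^sup>+p. cost (fst p) (snd p) \<partial>\<xi>))" .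
    define \<kappa> where "\<kappa> = convexity_const CARD('n) d B \<beta>"
    have \<kappa>: "\<kappa> \<ge> 0"
      using d pos by (simp add: \<kappa>_def convexity_const_def)
    \<comment> \<open>Squaring the share of the chosen direction produces the divisor
      \<open>(2 * n)\<^sup>2\<close>.\<close>
    have "((measure \<gamma>1 UNIV - measure \<gamma>0 UNIV) / (2 * n))\<^sup>2 \<le> (measure \<theta> UNIV)\<^sup>2"
      using share mass n by (intro power_mono) (auto simp: measure_def \<theta>_UNIV)
    then have "\<kappa> * ((measure \<gamma>1 UNIV - measure \<gamma>0 UNIV) / (2 * n))\<^sup>2 \<le> \<kappa> * (measure \<theta> UNIV)\<^sup>2"
      using \<kappa> by (rule mult_left_mono)
    then have k: "ennreal (\<kappa> / (2 * n)\<^sup>2 * (measure \<gamma>1 UNIV - measure \<gamma>0 UNIV)\<^sup>2) \<le> ennreal (\<kappa> * (measure \<theta> UNIV)\<^sup>2)"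
      by (intro ennreal_leI) (simp add: power_divide)
    have "2 * (\<integral>\<^sup>+p. cost (fst p) (snd p) \<partial>\<gamma>) + ennreal (\<kappa> / (2 * n)\<^sup>2 * (measure \<gamma>1 UNIV - measure \<gamma>0 UNIV)\<^sup>2)
      \<le> (\<integral>\<^sup>+p. cost (fst p) (snd p) \<partial>\<gamma>0) + ((\<integral>\<^sup>+p. cost (fst p) (snd p) \<partial>\<eta>)
        + ((\<integral>\<^sup>+p. cost (fst p) (snd p) \<partial>\<xi>) + ennreal (\<kappa> * (measure \<theta> UNIV)\<^sup>2)))"
      unfolding cost\<gamma> add.assoc by (intro add_left_mono k)
    also have "\<dots> \<le> (\<integral>\<^sup>+p. cost (fst p) (snd p) \<partial>\<gamma>0) + ((\<integral>\<^sup>+p. cost (fst p) (snd p) \<partial>\<eta>)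
        + ((\<integral>\<^sup>+p. ennreal (\<rho> (fst p)) * ennreal (cost (fst p) (snd p)) \<partial>\<theta>) + ennreal \<epsilon>))"
      unfolding \<kappa>_def by (intro add_left_mono \<xi>c)
    also have "\<dots> = (\<integral>\<^sup>+p. cost (fst p) (snd p) \<partial>\<gamma>0) + (\<integral>\<^sup>+p. cost (fst p) (snd p) \<partial>\<gamma>1) + ennreal \<epsilon>"
      using balance[of "\<lambda>p. ennreal (cost (fst p) (snd p))"] by (simp add: add.assoc[symmetric])
    finally show "2 * (\<integral>\<^sup>+p. cost (fst p) (snd p) \<partial>\<gamma>)
      + ennreal (convexity_const CARD('n) (\<delta> / CARD('n)) B \<beta> / (2 * CARD('n))\<^sup>2 * (measure \<gamma>1 UNIV - measure \<gamma>0 UNIV)\<^sup>2)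
      \<le> (\<integral>\<^sup>+p. cost (fst p) (snd p) \<partial>\<gamma>0) + (\<integral>\<^sup>+p. cost (fst p) (snd p) \<partial>\<gamma>1) + ennreal \<epsilon>"
      by (simp add: \<kappa>_def d_def n_def)
  qed
qed

section \<open>The optimal partial transport cost\<close>

lemma
  fixes f :: "'a::euclidean_space \<Rightarrow> real"
  assumes f: "integrable lebesgue f" "AE x in lebesgue. 0 \<le> f x"
  shows set_integral_eq_nn_integral:
      "A \<in> sets borel \<Longrightarrow> ennreal (LINT x:A|lebesgue. f x) = (\<integral>\<^sup>+x. ennreal (f x) * indicator A x \<partial>lebesgue)"
    and set_integral_split: "A \<in> sets borel \<Longrightarrow> P \<in> sets borel \<Longrightarrow>
      ennreal (LINT x:A|lebesgue. f x) = ennreal (LINT x:A \<inter> P|lebesgue. f x) + ennreal (LINT x:A - P|lebesgue. f x)"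
proof -
  have fm [measurable]: "f \<in> borel_measurable lebesgue"
    using f(1) by auto
  show eq: "ennreal (LINT x:A|lebesgue. f x) = (\<integral>\<^sup>+x. ennreal (f x) * indicator A x \<partial>lebesgue)"
    if "A \<in> sets borel" for A
  proof -
    have [measurable]: "A \<in> sets lebesgue"
      using that by simp
    have "integrable lebesgue (\<lambda>x. indicator A x *\<^sub>R f x)"
      by (rule integrable_mult_indicator[OF _ f(1)]) measurable
    then have "(\<integral>\<^sup>+x. ennreal (indicator A x *\<^sub>R f x) \<partial>lebesgue) = ennreal (LINT x:A|lebesgue. f x)"
      unfolding set_lebesgue_integral_def
      by (rule nn_integral_eq_integral) (use f(2) in \<open>auto elim!: eventually_mono simp: indicator_def\<close>)
    moreover have "(\<integral>\<^sup>+x. ennreal (indicator A x *\<^sub>R f x) \<partial>lebesgue) = (\<integral>\<^sup>+x. ennreal (f x) * indicator A x \<partial>lebesgue)"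
      by (intro nn_integral_cong) (simp add: indicator_def)
    ultimately show ?thesis
      by simp
  qed
  show "ennreal (LINT x:A|lebesgue. f x) = ennreal (LINT x:A \<inter> P|lebesgue. f x) + ennreal (LINT x:A - P|lebesgue. f x)"
    if A: "A \<in> sets borel" and P: "P \<in> sets borel"
  proof -
    have [measurable]: "A \<in> sets lebesgue" "P \<in> sets lebesgue"
      using that by auto
    have "(\<integral>\<^sup>+x. ennreal (f x) * indicator (A \<inter> P) x \<partial>lebesgue) + (\<integral>\<^sup>+x. ennreal (f x) * indicator (A - P) x \<partial>lebesgue)
        = (\<integral>\<^sup>+x. ennreal (f x) * indicator (A \<inter> P) x + ennreal (f x) * indicator (A - P) x \<partial>lebesgue)"
      by (rule nn_integral_add[symmetric]) measurable
    also have "\<dots> = (\<integral>\<^sup>+x. ennreal (f x) * indicator A x \<partial>lebesgue)"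
      by (intro nn_integral_cong) (auto simp: indicator_def)
    finally show ?thesis
      using A P by (simp add: eq)
  qed
qed

lemma set_integral_le_lborel:
  fixes f :: "'a::euclidean_space \<Rightarrow> real"
  assumes "integrable lebesgue f" "AE x in lebesgue. 0 \<le> f x" "AE x in lebesgue. f x \<le> \<beta>" "A \<in> sets borel"
  shows "ennreal (LINT x:A|lebesgue. f x) \<le> ennreal \<beta> * emeasure lborel A"
proof -
  have "(\<integral>\<^sup>+x. ennreal (f x) * indicator A x \<partial>lebesgue) \<le> (\<integral>\<^sup>+x. ennreal \<beta> * indicator A x \<partial>lebesgue)"
    using assms(3) by (intro nn_integral_mono_AE) (auto elim!: eventually_mono simp: indicator_def intro: ennreal_leI)
  also have "\<dots> = ennreal \<beta> * emeasure lborel A"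
    using assms(4) by (simp add: nn_integral_cmult_indicator)
  finally show ?thesis
    using assms by (simp add: set_integral_eq_nn_integral)
qed

lemma set_integral_outside_spt:
  fixes f :: "'a::euclidean_space \<Rightarrow> real"
  shows "(LINT x:- spt f|lebesgue. f x) = 0"
  unfolding set_lebesgue_integral_def using AE_zero_outside_spt[of f]
  by (intro integral_eq_zero_AE) (auto elim!: eventually_mono simp: indicator_def)

text \<open>Off the closure \<open>f\<close> vanishes a.e., and the frontier is a null set since the
  boundary is smooth; this leaves the open domain.\<close>

lemma AE_le_of_AE_le_domain:
  fixes f :: "'a::euclidean_space \<Rightarrow> real"
  assumes "smooth_bounded_domain \<Omega>" "spt f = closure \<Omega>" "\<beta> > 0"
    and le: "AE x in lebesgue. x \<in> \<Omega> \<longrightarrow> f x \<le> \<beta>"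
  shows "AE x in lebesgue. f x \<le> \<beta>"
proof -
  have op: "open \<Omega>" and neg: "negligible (frontier \<Omega>)"
    using assms(1) negligible_frontier_smooth by (auto simp: smooth_bounded_domain_def)
  have "AE x in lebesgue. x \<notin> frontier \<Omega>"
    using neg by (simp add: negligible_iff_null_sets AE_not_in)
  with le AE_zero_outside_spt[of f] show ?thesis
  proof eventually_elim
    case (elim x)
    then show ?case
      using op \<open>\<beta> > 0\<close> assms(2) by (auto simp: frontier_def interior_open)
  qed
qed

text \<open>Plans are concentrated on closures of the domains, and the distance of two sets does not
  change when they are closed.\<close>

lemma norm_ge_on_closures:
  fixes S T :: "'a::euclidean_space set"
  assumes "\<forall>x\<in>S. \<forall>y\<in>T. norm (x - y) \<ge> \<delta>" "x \<in> closure S" "y \<in> closure T"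
  shows "norm (x - y) \<ge> \<delta>"
proof -
  have "S \<noteq> {}" "T \<noteq> {}"
    using assms by auto
  then have "\<delta> \<le> setdist S T"
    using assms(1) by (intro le_setdistI) (auto simp: dist_norm)
  also have "\<dots> = setdist (closure S) (closure T)"
    by simp
  also have "\<dots> \<le> dist x y"
    using assms by (intro setdist_le_dist)
  finally show ?thesis
    by (simp add: dist_norm)
qed

theorem corollary4p6:
  fixes \<Omega> \<Lambda> :: "(real ^ 'n) set"
    and f g :: "real ^ 'n \<Rightarrow> real"
    and \<delta> \<beta>\<^sub>1 \<beta>\<^sub>2 :: real
  assumes "smooth_bounded_domain \<Omega>" and "smooth_bounded_domain \<Lambda>"
    and "hyperplane_separates \<Omega> \<Lambda>"
    and "\<delta> > 0" and "\<forall>x\<in>\<Omega>. \<forall>y\<in>\<Lambda>. norm (x - y) \<ge> \<delta>"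
    and "integrable lebesgue f" and "integrable lebesgue g"
    and "AE x in lebesgue. 0 \<le> f x" and "AE y in lebesgue. 0 \<le> g y"
    and "(LINT x|lebesgue. f x) = 1" and "(LINT y|lebesgue. g y) = 1"
    and "spt f = closure \<Omega>" and "spt g = closure \<Lambda>"
    and "\<beta>\<^sub>1 > 0" and "\<beta>\<^sub>2 > 0"
    and "AE x in lebesgue. x \<in> \<Omega> \<longrightarrow> \<beta>\<^sub>1 \<le> f x \<and> f x \<le> \<beta>\<^sub>2"
    and "AE y in lebesgue. y \<in> \<Lambda> \<longrightarrow> \<beta>\<^sub>1 \<le> g y \<and> g y \<le> \<beta>\<^sub>2"
  shows "C11_on {0..} (C_cost f g)"
proof -
  define F where "F A = ennreal (LINT x:A|lebesgue. f x)" for A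
  define G where "G A = ennreal (LINT x:A|lebesgue. g x)" for A
  have split: "F A = F (A \<inter> P) + F (A - P)" if "A \<in> sets borel" "P \<in> sets borel" for A P
    unfolding F_def using set_integral_split assms that by blast
  have "AE x in lebesgue. f x \<le> \<beta>\<^sub>2"
    using assms by (intro AE_le_of_AE_le_domain[of \<Omega>]) (auto elim: eventually_mono)
  then have dens: "F A \<le> ennreal \<beta>\<^sub>2 * emeasure lborel A" if "A \<in> sets borel" for A
    unfolding F_def using assms that by (intro set_integral_le_lborel)
  have F_UNIV: "F UNIV = 1"
    using assms(10) by (simp add: F_def set_lebesgue_integral_def)
  have F_out: "F (- closure \<Omega>) = 0" and G_out: "G (- closure \<Lambda>) = 0"
    using set_integral_outside_spt[of f] set_integral_outside_spt[of g] assms(12,13)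
    by (simp_all add: F_def G_def)
  have "bounded (closure \<Omega> \<union> closure \<Lambda>)"
    using assms(1,2) by (simp add: smooth_bounded_domain_def bounded_closure)
  then obtain B where B: "B > 0" "\<And>x. x \<in> closure \<Omega> \<union> closure \<Lambda> \<Longrightarrow> norm x \<le> B"
    unfolding bounded_pos by blast
  define \<G> where "\<G> = Gamma_le f g"
  have sets_\<gamma>: "sets \<gamma> = sets borel"
    and le_F: "\<And>A. A \<in> sets borel \<Longrightarrow> emeasure \<gamma> (A \<times> UNIV) \<le> F A"
    and le_G: "\<And>A. A \<in> sets borel \<Longrightarrow> emeasure \<gamma> (UNIV \<times> A) \<le> G A" if "\<gamma> \<in> \<G>" for \<gamma>
    using that by (auto simp: \<G>_def Gamma_le_def F_def G_def)
  have \<G>I: "\<gamma> \<in> \<G>" if "sets \<gamma> = sets borel"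
      "\<And>A. A \<in> sets borel \<Longrightarrow> emeasure \<gamma> (A \<times> UNIV) \<le> F A"
      "\<And>A. A \<in> sets borel \<Longrightarrow> emeasure \<gamma> (UNIV \<times> A) \<le> G A" for \<gamma>
    using that by (auto simp: \<G>_def Gamma_le_def F_def G_def)
  have "null_measure borel \<in> \<G>"
    by (rule \<G>I) auto
  then have ne: "\<G> \<noteq> {}"
    by auto
  \<comment> \<open>The marginal bounds vanish outside the supports of the densities, so no mass
    starts or ends there.\<close>
  have conc: "AE p in \<gamma>. fst p \<in> closure \<Omega> \<and> snd p \<in> closure \<Lambda>" if "\<gamma> \<in> \<G>" for \<gamma>
  proof -
    have boxes: "(- closure \<Omega>) \<times> UNIV \<in> sets \<gamma>" "UNIV \<times> (- closure \<Lambda>) \<in> sets \<gamma>"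
      unfolding sets_\<gamma>[OF that] borel_prod[symmetric] by auto
    have "emeasure \<gamma> ((- closure \<Omega>) \<times> UNIV) = 0" "emeasure \<gamma> (UNIV \<times> (- closure \<Lambda>)) = 0"
      using le_F[OF that, of "- closure \<Omega>"] le_G[OF that, of "- closure \<Lambda>"] F_out G_out by auto
    then have "AE p in \<gamma>. p \<notin> (- closure \<Omega>) \<times> UNIV" "AE p in \<gamma>. p \<notin> UNIV \<times> (- closure \<Lambda>)"
      using boxes by (auto intro!: AE_not_in simp: null_sets_def)
    then show ?thesis
      by eventually_elim auto
  qed
  have conc': "AE p in \<gamma>. (\<forall>j. \<bar>fst p$j\<bar> \<le> B) \<and> (\<forall>j. \<bar>snd p$j\<bar> \<le> B) \<and> \<delta> \<le> norm (fst p - snd p)"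
    if "\<gamma> \<in> \<G>" for \<gamma>
    using conc[OF that]
  proof eventually_elim
    case (elim p)
    then show ?case
      using B(2)[of "fst p"] B(2)[of "snd p"] component_le_norm_cart[of "fst p"] component_le_norm_cart[of "snd p"]
        norm_ge_on_closures[OF assms(5), of "fst p" "snd p"] by (auto intro: order_trans)
  qed
  have fin: "finite_measure \<gamma>" and mass_1: "measure \<gamma> UNIV \<le> 1" if "\<gamma> \<in> \<G>" for \<gamma>
  proof -
    have le: "emeasure \<gamma> UNIV \<le> 1"
      using le_F[OF that, of UNIV] F_UNIV by simp
    have "space \<gamma> = UNIV"
      using sets_eq_imp_space_eq[OF sets_\<gamma>[OF that]] by simp
    then show "finite_measure \<gamma>"
      using le by (intro finite_measureI) (auto simp: top_unique)
    show "measure \<gamma> UNIV \<le> 1"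
      using le by (simp add: measure_def enn2real_leI)
  qed
  define J where "J \<gamma> = (LINT p|\<gamma>. cost (fst p) (snd p))" for \<gamma> :: "((real^'n) \<times> (real^'n)) measure"
  define m where "m \<gamma> = measure \<gamma> UNIV" for \<gamma> :: "((real^'n) \<times> (real^'n)) measure"
  have intg: "integrable \<gamma> (\<lambda>p. cost (fst p) (snd p))" if "\<gamma> \<in> \<G>" for \<gamma>
  proof -
    interpret finite_measure \<gamma>
      by (rule fin[OF that])
    show ?thesis
    proof (rule integrable_const_bound[of _ "1/2 * (2 * B)\<^sup>2"])
      show "AE p in \<gamma>. norm (cost (fst p) (snd p)) \<le> 1/2 * (2 * B)\<^sup>2"
        using conc[OF that]
      proof eventually_elim
        case (elim p)
        have "norm (fst p - snd p) \<le> 2 * B"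
          using elim B(2)[of "fst p"] B(2)[of "snd p"] norm_triangle_ineq4[of "fst p" "snd p"] by auto
        then show ?case
          unfolding cost_def using power_mono[of "norm (fst p - snd p)" "2 * B" 2] by simp
      qed
      show "(\<lambda>p. cost (fst p) (snd p)) \<in> borel_measurable \<gamma>"
        using cost_measurable by (simp add: measurable_cong_sets[OF sets_\<gamma>[OF that] refl])
    qed
  qed
  have J_nn: "(\<integral>\<^sup>+p. cost (fst p) (snd p) \<partial>\<gamma>) = ennreal (J \<gamma>)" if "\<gamma> \<in> \<G>" for \<gamma>
    unfolding J_def by (rule nn_integral_eq_integral[OF intg[OF that]]) (simp add: cost_nonneg)
  have J_pos: "J \<gamma> \<ge> 0" for \<gamma>
    unfolding J_def by (intro integral_nonneg_AE) (simp add: cost_nonneg)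
  \<comment> \<open>The functional sees a plan only through its cost \<open>J\<close> and its mass
    \<open>m\<close>, and is affine in \<open>l\<close> with slope
    \<open>- m \<gamma>\<close>.\<close>
  have functional_eq: "(LINT (x, y)|\<gamma>. cost x y - l) = J \<gamma> - l * m \<gamma>" if "\<gamma> \<in> \<G>" for \<gamma> l
  proof -
    interpret finite_measure \<gamma>
      by (rule fin[OF that])
    have "space \<gamma> = UNIV"
      using sets_eq_imp_space_eq[OF sets_\<gamma>[OF that]] by simp
    then show ?thesis
      unfolding J_def m_def case_prod_beta' using intg[OF that] by (subst Bochner_Integration.integral_diff) auto
  qed
  have C_eq: "C_cost f g l = (INF \<gamma>\<in>\<G>. J \<gamma> - l * m \<gamma>)" for l
    unfolding C_cost_def \<G>_def[symmetric] by (intro INF_cong refl functional_eq)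
  \<comment> \<open>A real infimum is a genuine lower bound only for a family bounded below; here
    masses are at most 1 and costs nonnegative.\<close>
  have bdd: "bdd_below ((\<lambda>\<gamma>. J \<gamma> - l * m \<gamma>) ` \<G>)" for l
  proof (rule bdd_belowI2)
    fix \<gamma> assume "\<gamma> \<in> \<G>"
    then have "0 \<le> m \<gamma>" "m \<gamma> \<le> 1"
      using mass_1 by (auto simp: m_def)
    then have "l * m \<gamma> \<le> \<bar>l\<bar> * 1"
      by (intro mult_mono) auto
    then show "- \<bar>l\<bar> \<le> J \<gamma> - l * m \<gamma>"
      using J_pos[of \<gamma>] by simp
  qed
  have C_le: "C_cost f g l \<le> J \<gamma> - l * m \<gamma>" if "\<gamma> \<in> \<G>" for \<gamma> l
    unfolding C_eq by (rule cINF_lower[OF bdd that])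
  have C_ge: "c \<le> C_cost f g l" if "\<And>\<gamma>. \<gamma> \<in> \<G> \<Longrightarrow> c \<le> J \<gamma> - l * m \<gamma>" for c l
    unfolding C_eq by (rule cINF_greatest[OF ne that])
  \<comment> \<open>An infimum of affine functions; negative parameters are included, which makes 0
    an interior point.\<close>
  have concave: "convex_on UNIV (\<lambda>l. - C_cost f g l)"
  proof (rule convex_onI)
    fix t x y :: real assume t: "0 < t" "t < 1"
    have "(1 - t) * C_cost f g x + t * C_cost f g y \<le> C_cost f g ((1 - t) * x + t * y)"
    proof (rule C_ge)
      fix \<gamma> assume \<gamma>: "\<gamma> \<in> \<G>"
      have "(1 - t) * C_cost f g x + t * C_cost f g y
          \<le> (1 - t) * (J \<gamma> - x * m \<gamma>) + t * (J \<gamma> - y * m \<gamma>)"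
        using t by (intro add_mono mult_left_mono C_le \<gamma>) auto
      also have "\<dots> = J \<gamma> - ((1 - t) * x + t * y) * m \<gamma>"
        by (simp add: algebra_simps)
      finally show "(1 - t) * C_cost f g x + t * C_cost f g y \<le> J \<gamma> - ((1 - t) * x + t * y) * m \<gamma>" .
    qed
    then show "- C_cost f g ((1 - t) *\<^sub>R x + t *\<^sub>R y) \<le> (1 - t) * - C_cost f g x + t * - C_cost f g y"
      by simp
  qed simp
  define k where "k = convexity_const CARD('n) (\<delta> / CARD('n)) B \<beta>\<^sub>2 / (2 * CARD('n))\<^sup>2"
  have k: "k > 0"
    unfolding k_def convexity_const_def using B(1) assms(4,15)
    by (intro divide_pos_pos mult_pos_pos zero_less_power add_nonneg_pos) auto
  have mid1: "\<exists>\<gamma>\<in>\<G>. 2 * m \<gamma> = m \<gamma>0 + m \<gamma>1 \<and> 2 * J \<gamma> + k * (m \<gamma>1 - m \<gamma>0)\<^sup>2 \<le> J \<gamma>0 + J \<gamma>1 + \<epsilon>"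
    if \<gamma>0: "\<gamma>0 \<in> \<G>" and \<gamma>1: "\<gamma>1 \<in> \<G>" and "m \<gamma>0 \<le> m \<gamma>1" "\<epsilon> > 0" for \<gamma>0 \<gamma>1 \<epsilon>
  proof (rule strong_convexity[of \<gamma>0 \<gamma>1 F G \<beta>\<^sub>2 B \<delta> \<epsilon>], goal_cases)
    case (16 \<gamma>)
    have \<gamma>: "\<gamma> \<in> \<G>"
      by (rule \<G>I) (fact 16)+
    interpret \<gamma>: finite_measure \<gamma>
      by (rule fin[OF \<gamma>])
    interpret \<gamma>0: finite_measure \<gamma>0
      by (rule fin[OF \<gamma>0])
    interpret \<gamma>1: finite_measure \<gamma>1
      by (rule fin[OF \<gamma>1])
    have "ennreal (2 * m \<gamma>) = ennreal (m \<gamma>0 + m \<gamma>1)"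
      using 16(4) unfolding m_def \<gamma>.emeasure_eq_measure \<gamma>0.emeasure_eq_measure \<gamma>1.emeasure_eq_measure
      by (simp add: ennreal_mult)
    then have "2 * m \<gamma> = m \<gamma>0 + m \<gamma>1"
      by (subst (asm) ennreal_inj) (auto simp: m_def)
    moreover have "ennreal (2 * J \<gamma> + k * (m \<gamma>1 - m \<gamma>0)\<^sup>2) \<le> ennreal (J \<gamma>0 + J \<gamma>1 + \<epsilon>)"
      using 16(5) k \<open>\<epsilon> > 0\<close> J_pos[of \<gamma>] J_pos[of \<gamma>0] J_pos[of \<gamma>1]
      unfolding J_nn[OF \<gamma>] J_nn[OF \<gamma>0] J_nn[OF \<gamma>1] k_def[symmetric] m_def[symmetric]
      by (simp add: ennreal_plus ennreal_mult)
    then have "2 * J \<gamma> + k * (m \<gamma>1 - m \<gamma>0)\<^sup>2 \<le> J \<gamma>0 + J \<gamma>1 + \<epsilon>"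
      using J_pos[of \<gamma>0] J_pos[of \<gamma>1] \<open>\<epsilon> > 0\<close> by (subst (asm) ennreal_le_iff) auto
    ultimately show ?case
      using \<gamma> by blast
  next
    case (5 A)
    then show ?case by (rule le_G[OF \<gamma>0])
  next
    case (6 A)
    then show ?case by (rule le_G[OF \<gamma>1])
  next
    case (7 A P)
    then show ?case by (rule split)
  qed (use sets_\<gamma> le_F \<gamma>0 \<gamma>1 dens F_UNIV assms(4,15) B(1) that(3,4) conc'[OF \<gamma>1] in \<open>auto simp: m_def\<close>)
  \<comment> \<open>The claim is symmetric in the two plans, so they may be ordered by mass.\<close>
  have mid: "\<exists>\<gamma>\<in>\<G>. 2 * m \<gamma> = m \<gamma>0 + m \<gamma>1 \<and> 2 * J \<gamma> + k * (m \<gamma>1 - m \<gamma>0)\<^sup>2 \<le> J \<gamma>0 + J \<gamma>1 + \<epsilon>"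
    if "\<gamma>0 \<in> \<G>" "\<gamma>1 \<in> \<G>" "\<epsilon> > 0" for \<gamma>0 \<gamma>1 \<epsilon>
    using mid1[of \<gamma>0 \<gamma>1 \<epsilon>] mid1[of \<gamma>1 \<gamma>0 \<epsilon>] that
    by (cases "m \<gamma>0 \<le> m \<gamma>1") (auto simp: power2_commute[of "m \<gamma>0"] add.commute)
  \<comment> \<open>This is the second difference bound before taking infima, with
    \<open>\<gamma>1\<close> tested at \<open>l + e\<close>, \<open>\<gamma>0\<close> at
    \<open>l - e\<close> and their improved midpoint at \<open>l\<close>.\<close>
  have semi_pair: "2 * C_cost f g l - 1 / (4 * k) * e\<^sup>2 \<le> (J \<gamma>1 - (l + e) * m \<gamma>1) + (J \<gamma>0 - (l - e) * m \<gamma>0)"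
    if \<gamma>01: "\<gamma>0 \<in> \<G>" "\<gamma>1 \<in> \<G>" for \<gamma>0 \<gamma>1 l e
  proof (rule field_le_epsilon)
    fix \<epsilon> :: real assume "\<epsilon> > 0"
    then obtain \<gamma> where \<gamma>: "\<gamma> \<in> \<G>" "2 * m \<gamma> = m \<gamma>0 + m \<gamma>1"
        "2 * J \<gamma> + k * (m \<gamma>1 - m \<gamma>0)\<^sup>2 \<le> J \<gamma>0 + J \<gamma>1 + \<epsilon>"
      using mid[OF \<gamma>01] by blast
    define H where "H = m \<gamma>1 - m \<gamma>0"
    \<comment> \<open>Completing the square: the minimum of \<open>k * H\<^sup>2 - e * H\<close>
      over \<open>H\<close> is at \<open>e / (2 * k)\<close> and equals
      \<open>- e\<^sup>2 / (4 * k)\<close>, whence the constant \<open>1 / (4 * k)\<close>.\<close>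
    have "0 \<le> k * (H - e / (2 * k))\<^sup>2"
      using k by simp
    also have "\<dots> = k * H\<^sup>2 - e * H + 1 / (4 * k) * e\<^sup>2"
      using k by (simp add: power2_eq_square field_simps)
    finally have "e * H - 1 / (4 * k) * e\<^sup>2 \<le> k * H\<^sup>2"
      by simp
    moreover have "2 * C_cost f g l \<le> 2 * J \<gamma> - l * (2 * m \<gamma>)"
      using C_le[OF \<gamma>(1), of l] by simp
    moreover have "e * H = e * m \<gamma>1 - e * m \<gamma>0" "l * (m \<gamma>0 + m \<gamma>1) = l * m \<gamma>0 + l * m \<gamma>1"
      by (simp_all add: H_def algebra_simps)
    ultimately show "2 * C_cost f g l - 1 / (4 * k) * e\<^sup>2
        \<le> (J \<gamma>1 - (l + e) * m \<gamma>1) + (J \<gamma>0 - (l - e) * m \<gamma>0) + \<epsilon>"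
      using \<gamma>(2,3) unfolding H_def[symmetric] distrib_right left_diff_distrib by simp
  qed
  have semi: "C_cost f g (l + e) + C_cost f g (l - e) \<ge> 2 * C_cost f g l - 1 / (4 * k) * e\<^sup>2" for l e
  proof -
    \<comment> \<open>The infima over \<open>\<gamma>0\<close> and \<open>\<gamma>1\<close> are
      taken one after the other, each time with the other terms moved to the left.\<close>
    have "2 * C_cost f g l - 1 / (4 * k) * e\<^sup>2 - C_cost f g (l + e) \<le> C_cost f g (l - e)"
    proof (rule C_ge)
      fix \<gamma>0 assume \<gamma>0: "\<gamma>0 \<in> \<G>"
      have "2 * C_cost f g l - 1 / (4 * k) * e\<^sup>2 - (J \<gamma>0 - (l - e) * m \<gamma>0) \<le> C_cost f g (l + e)"
      proof (rule C_ge)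
        fix \<gamma>1 assume "\<gamma>1 \<in> \<G>"
        from semi_pair[OF \<gamma>0 this, of l e]
        show "2 * C_cost f g l - 1 / (4 * k) * e\<^sup>2 - (J \<gamma>0 - (l - e) * m \<gamma>0) \<le> J \<gamma>1 - (l + e) * m \<gamma>1"
          by linarith
      qed
      then show "2 * C_cost f g l - 1 / (4 * k) * e\<^sup>2 - C_cost f g (l + e) \<le> J \<gamma>0 - (l - e) * m \<gamma>0"
        by linarith
    qed
    then show ?thesis
      by linarith
  qed
  show ?thesis
    using concave semi by (rule C11_on_of_concave_semiconvex)
qed

end
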